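(* For every finite connected weighted graph $G=(V,(c_{xy})_{x,y\in V})$ and all positive site weights $\alpha=(\alpha_x)_{x\in V}$, $$\alpha_{\min}\left\{\frac{1}{54}\,\frac{\alpha_{\rm ratio}}{(6e)^{\alpha_{\min}/\alpha_{\rm ratio}}}\,\frac{c_{\min}}{|V|^2\,{\rm diam}(G)}\right\}\le {\rm gap}_{\rm SIP}(G,\alpha),$$ where $$\alpha_{\rm ratio}=\frac{\alpha_{\min}}{\alpha_{\max}}=\frac{\min_{x\in V}\alpha_x}{\max_{y\in V}\alpha_y}\le 1,\qquad c_{\min}=\min_{x,y\in V:\,c_{xy}>0}c_{xy}>0 .$$
   Context: $G=(V,(c_{xy})_{x,y\in V})$ is a finite graph with $|V|\ge 2$, symmetric conductances $c_{xy}=c_{yx}\ge 0$, $c_{xx}=0$, connected: any two sites are joined by a sequence of sites with positive conductance between consecutive ones. The graph distance of two distinct sites is the length (number of steps) of the shortest such sequence, and ${\rm diam}(G)$ is the largest graph distance. Site weights satisfy $\alpha_x>0$; $\alpha_{\min}=\min_x\alpha_x$, $\alpha_{\max}=\max_x\alpha_x$, $|\alpha|=\sum_x\alpha_x$. For $k\in\mathbb N$ let $\Xi_k=\{\eta\in\mathbb N_0^V:\sum_{x\in V}\eta_x=k\}$. The symmetric inclusion process ${\rm SIP}_k(G,\alpha)$ is the continuous-time Markov chain on $\Xi_k$ with generator, for $f\in\mathbb R^{\Xi_k}$, $$L_{G,\alpha,k}f(\eta)=\sum_{x,y\in V}c_{xy}\,\eta_x(\alpha_y+\eta_y)\big(f(\eta-\delta_x+\delta_y)-f(\eta)\big).$$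 It is irreducible and reversible with respect to the probability measure $\mu_{\alpha,k}(\eta)=\frac{1}{Z_{\alpha,k}}\prod_{x\in V}\frac{\Gamma(\alpha_x+\eta_x)}{\Gamma(\alpha_x)\,\eta_x!}$, $Z_{\alpha,k}=\frac{\Gamma(|\alpha|+k)}{\Gamma(|\alpha|)\,k!}$. ${\rm gap}_k(G,\alpha)>0$ denotes the second smallest eigenvalue of $-L_{G,\alpha,k}$ (all eigenvalues are real and non-negative, and $0$ is simple), and ${\rm gap}_{\rm SIP}(G,\alpha)=\inf_{k\ge 2}{\rm gap}_k(G,\alpha)$. *)

theory Defs
  imports "HOL-Analysis.Analysis" "HOL-Library.Function_Algebras"
begin

section \<open>Weighted graphs\<close>

text \<open>
  The vertex set is the (arbitrary) finite type \<open>'v\<close>. A weighted graph is given by its conductances.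
\<close>

definition cond_edges :: "('v \<Rightarrow> 'v \<Rightarrow> real) \<Rightarrow> ('v \<times> 'v) set" where
  "cond_edges c = {(x, y). c x y > 0}"

definition connected_weighted_graph :: "('v::finite \<Rightarrow> 'v \<Rightarrow> real) \<Rightarrow> bool" where
  "connected_weighted_graph c \<longleftrightarrow>
     (\<forall>x y. c x y = c y x) \<and> (\<forall>x y. c x y \<ge> 0) \<and> (\<forall>x. c x x = 0) \<and>
     (\<forall>x y. (x, y) \<in> (cond_edges c)\<^sup>*)"

definition graph_distance :: "('v \<Rightarrow> 'v \<Rightarrow> real) \<Rightarrow> 'v \<Rightarrow> 'v \<Rightarrow> nat" where
  "graph_distance c x y = (LEAST n. (x, y) \<in> cond_edges c ^^ n)"

definition graph_diam :: "('v::finite \<Rightarrow> 'v \<Rightarrow> real) \<Rightarrow> nat" where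
  "graph_diam c = Max {graph_distance c x y | x y. x \<noteq> y}"

definition c_min :: "('v::finite \<Rightarrow> 'v \<Rightarrow> real) \<Rightarrow> real" where
  "c_min c = Min {c x y | x y. c x y > 0}"

definition alpha_min :: "('v::finite \<Rightarrow> real) \<Rightarrow> real" where
  "alpha_min \<alpha> = Min (range \<alpha>)"

definition alpha_max :: "('v::finite \<Rightarrow> real) \<Rightarrow> real" where
  "alpha_max \<alpha> = Max (range \<alpha>)"

definition alpha_ratio :: "('v::finite \<Rightarrow> real) \<Rightarrow> real" where
  "alpha_ratio \<alpha> = alpha_min \<alpha> / alpha_max \<alpha>"

section \<open>The symmetric inclusion process\<close>

definition configs :: "nat \<Rightarrow> ('v::finite \<Rightarrow> nat) set" where
  "configs k = {\<eta>. (\<Sum>x\<in>UNIV. \<eta> x) = k}"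

text \<open>
  The configuration \<open>\<eta> - \<delta>\<^sub>x + \<delta>\<^sub>y\<close>. The truncated subtraction only matters when \<open>\<eta> x = 0\<close>,
  and then the jump rate out of \<open>x\<close> vanishes.
\<close>

definition move :: "'v \<Rightarrow> 'v \<Rightarrow> ('v \<Rightarrow> nat) \<Rightarrow> 'v \<Rightarrow> nat" where
  "move x y \<eta> = (\<lambda>z. \<eta> z - of_bool (z = x) + of_bool (z = y))"

definition sip_generator ::
    "('v::finite \<Rightarrow> 'v \<Rightarrow> real) \<Rightarrow> ('v \<Rightarrow> real) \<Rightarrow> (('v \<Rightarrow> nat) \<Rightarrow> real) \<Rightarrow> ('v \<Rightarrow> nat) \<Rightarrow> real" where
  "sip_generator c \<alpha> f \<eta> =
     (\<Sum>x\<in>UNIV. \<Sum>y\<in>UNIV.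
        c x y * real (\<eta> x) * (\<alpha> y + real (\<eta> y)) * (f (move x y \<eta>) - f \<eta>))"

section \<open>Spectral gap\<close>

text \<open>
  The space of functions on \<open>configs k\<close> is represented by the functions on all of \<open>'v \<Rightarrow> nat\<close>
  that vanish outside \<open>configs k\<close>. Only real eigenvalues are considered: the generator is
  self-adjoint in a weighted inner product, so there are no others, and geometric and algebraic
  multiplicities agree.
\<close>

global_interpretation fun_space: vector_space "\<lambda>(r::real) (f::'a \<Rightarrow> real) x. r * f x"
  by unfold_locales (auto simp: fun_eq_iff algebra_simps)

definition sip_eigenspace ::
    "('v::finite \<Rightarrow> 'v \<Rightarrow> real) \<Rightarrow> ('v \<Rightarrow> real) \<Rightarrow> nat \<Rightarrow> real \<Rightarrow> (('v \<Rightarrow> nat) \<Rightarrow> real) set" where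
  "sip_eigenspace c \<alpha> k \<theta> =
     {f. (\<forall>\<eta>. \<eta> \<notin> configs k \<longrightarrow> f \<eta> = 0) \<and>
         (\<forall>\<eta>\<in>configs k. - sip_generator c \<alpha> f \<eta> = \<theta> * f \<eta>)}"

definition sip_eigenvalues :: "('v::finite \<Rightarrow> 'v \<Rightarrow> real) \<Rightarrow> ('v \<Rightarrow> real) \<Rightarrow> nat \<Rightarrow> real set" where
  "sip_eigenvalues c \<alpha> k = {\<theta>. \<exists>f\<in>sip_eigenspace c \<alpha> k \<theta>. f \<noteq> (\<lambda>_. 0)}"

text \<open>The eigenvalues in nondecreasing order, each repeated according to its multiplicity.\<close>

definition sip_spectrum :: "('v::finite \<Rightarrow> 'v \<Rightarrow> real) \<Rightarrow> ('v \<Rightarrow> real) \<Rightarrow> nat \<Rightarrow> real list" where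
  "sip_spectrum c \<alpha> k =
     concat (map (\<lambda>\<theta>. replicate (fun_space.dim (sip_eigenspace c \<alpha> k \<theta>)) \<theta>)
                 (sorted_list_of_set (sip_eigenvalues c \<alpha> k)))"

definition sip_gap_k :: "('v::finite \<Rightarrow> 'v \<Rightarrow> real) \<Rightarrow> ('v \<Rightarrow> real) \<Rightarrow> nat \<Rightarrow> real" where
  "sip_gap_k c \<alpha> k = sip_spectrum c \<alpha> k ! 1"

definition sip_gap :: "('v::finite \<Rightarrow> 'v \<Rightarrow> real) \<Rightarrow> ('v \<Rightarrow> real) \<Rightarrow> real" where
  "sip_gap c \<alpha> = (INF k\<in>{2..}. sip_gap_k c \<alpha> k)"

end

theory Submission
  imports Defs
begin

text \<open>
  The bound follows from a Poincare inequality for the inclusion process whose constant does not depend on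
  the number \<open>k\<close> of particles. The reversible measure is the law of the colour counts of a Polya urn
  after \<open>k\<close> draws, and the proof exploits this in four ways.

  On two sites, induction on the number of draws gives the Poincare inequality with the optimal constant,
  the sum of the two weights (lemma \<open>two_site_poincare\<close>). Conditioning on the remaining sites, the
  energy of jumps across an edge \<open>uv\<close> controls, with constant \<open>\<alpha> u + \<alpha> v\<close>, the squared distance from \<open>f\<close> to
  the functions that cannot see how particles are divided between \<open>u\<close> and \<open>v\<close> (\<open>pair_poincare\<close>). This
  is linear in the weights, however small they are, because whole piles of particles are redistributed at
  once; routing single particles through empty sites would lose a further factor of the order of the weights.

  To pass from edges to arbitrary pairs \<open>x\<close>, \<open>y\<close>, every site is split into a slot of weight \<open>alpha_min \<alpha>\<close>
  and a remainder, which does not change the law of the totals. Slots are exchangeable, so the slot of \<open>x\<close>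
  can be carried along a geodesic to a neighbour of \<open>y\<close> by swaps, each of which costs no more than twice the distance
  attached to its edge. Hence \<open>f\<close> is close to a function that is indifferent to transfers between the
  slot of \<open>x\<close> and the site \<open>y\<close> (\<open>dist_indifferent_le_path\<close>).

  A function that is close to an indifferent function for every pair is close to a constant. This is an
  induction on the draws of the urn: averaging over the last draw preserves indifference, and in the
  fluctuations of the last draw the indifferent functions cancel, leaving a share
  \<open>alpha_ratio \<alpha>\<close> of the variance of \<open>f\<close> (\<open>variance_le_sum_dist_indifferent\<close>).

  Together these give \<open>alpha_min \<alpha> * alpha_ratio \<alpha> * c_min c / (4 * CARD('v)\<^sup>2 * graph_diam c)\<close> as a
  Poincare constant (\<open>sip_poincare\<close>), which is stronger than the claim as \<open>54 * (6 * exp 1) powr s \<ge> 4\<close> for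
  \<open>s \<ge> 0\<close>. Applied to an eigenfunction it bounds all nonzero eigenvalues from below and
  shows that \<open>0\<close> is simple. That the second entry of the spectrum is a nonzero eigenvalue at all uses
  the existence of one, obtained by minimising the energy over a compact sphere of functions of mean zero.
\<close>

section \<open>Polya urns\<close>

definition polya_weight :: "real \<Rightarrow> nat \<Rightarrow> real" where
  "polya_weight a n = pochhammer a n / fact n"

text \<open>
  The reversible measure of the inclusion process without its normalising constant: the
  Dirichlet-multinomial distribution, which is the law of the colour counts after \<open>k\<close> draws from a
  Polya urn with initial weights \<open>\<beta>\<close>. Weights equal to \<open>0\<close> are meaningful: such a site stays empty.
\<close>

definition weight :: "('a::finite \<Rightarrow> real) \<Rightarrow> ('a \<Rightarrow> nat) \<Rightarrow> real" where
  "weight \<beta> \<eta> = (\<Prod>x\<in>UNIV. polya_weight (\<beta> x) (\<eta> x))"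

definition add_at :: "('a \<Rightarrow> nat) \<Rightarrow> 'a \<Rightarrow> 'a \<Rightarrow> nat" where
  "add_at \<xi> x = \<xi>(x := Suc (\<xi> x))"

definition msum :: "('a::finite \<Rightarrow> real) \<Rightarrow> nat \<Rightarrow> (('a \<Rightarrow> nat) \<Rightarrow> real) \<Rightarrow> real" where
  "msum \<beta> k F = (\<Sum>\<eta>\<in>configs k. weight \<beta> \<eta> * F \<eta>)"

text \<open>
  The expectation of \<open>F\<close> after one further draw from the urn with current composition \<open>\<beta> + \<xi>\<close>.
\<close>

definition polya_mean :: "('a::finite \<Rightarrow> real) \<Rightarrow> (('a \<Rightarrow> nat) \<Rightarrow> real) \<Rightarrow> ('a \<Rightarrow> nat) \<Rightarrow> real" where
  "polya_mean \<beta> F \<xi> =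
     (\<Sum>x\<in>UNIV. (\<beta> x + real (\<xi> x)) * F (add_at \<xi> x)) / (\<Sum>x\<in>UNIV. \<beta> x + real (\<xi> x))"

lemma polya_weight_0 [simp]: "polya_weight a 0 = 1"
  by (simp add: polya_weight_def)

lemma polya_weight_Suc: "real (Suc n) * polya_weight a (Suc n) = (a + real n) * polya_weight a n"
  by (simp add: polya_weight_def pochhammer_Suc fact_Suc divide_simps del: of_nat_Suc)

lemma polya_weight_nonneg: "a \<ge> 0 \<Longrightarrow> polya_weight a n \<ge> 0"
  by (cases "a = 0") (auto simp: polya_weight_def pochhammer_0_left pochhammer_nonneg)

lemma polya_weight_pos: "a > 0 \<Longrightarrow> polya_weight a n > 0"
  by (simp add: polya_weight_def pochhammer_pos)

lemma weight_nonneg: "(\<And>x. \<beta> x \<ge> 0) \<Longrightarrow> weight \<beta> \<eta> \<ge> 0"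
  by (simp add: weight_def prod_nonneg polya_weight_nonneg)

lemma weight_pos: "(\<And>x. \<beta> x > 0) \<Longrightarrow> weight \<beta> \<eta> > 0"
  by (simp add: weight_def prod_pos polya_weight_pos)

lemma add_at_same [simp]: "add_at \<xi> x x = Suc (\<xi> x)"
  and add_at_other [simp]: "z \<noteq> x \<Longrightarrow> add_at \<xi> x z = \<xi> z"
  by (auto simp: add_at_def)

lemma add_at_remove: "(add_at \<xi> x)(x := \<xi> x) = \<xi>"
  by (simp add: add_at_def)

lemma add_at_commute: "add_at (add_at \<xi> x) y = add_at (add_at \<xi> y) x"
  by (auto simp: add_at_def fun_eq_iff)

lemma finite_configs [simp]: "finite (configs k :: ('a::finite \<Rightarrow> nat) set)"
proof -
  have "configs k \<subseteq> (\<Pi>\<^sub>E x\<in>(UNIV::'a set). {..k})"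
    by (auto simp: configs_def intro!: member_le_sum)
  then show ?thesis
    by (rule finite_subset) (auto intro: finite_PiE)
qed

lemma add_at_configs_iff [simp]: "add_at \<xi> x \<in> configs (Suc k) \<longleftrightarrow> \<xi> \<in> configs k"
proof -
  have "sum (add_at \<xi> x) UNIV = Suc (sum \<xi> UNIV)"
    by (simp add: sum.remove[of UNIV x "add_at \<xi> x"] sum.remove[of UNIV x \<xi>])
  then show ?thesis by (simp add: configs_def)
qed

lemma configs_0: "configs 0 = {\<lambda>_. 0}"
  by (auto simp: configs_def)

lemma weight_add_at: "real (Suc (\<xi> x)) * weight \<beta> (add_at \<xi> x) = (\<beta> x + real (\<xi> x)) * weight \<beta> \<xi>"
proof -
  have *: "weight \<beta> \<zeta> = polya_weight (\<beta> x) (\<zeta> x) * (\<Prod>z\<in>UNIV-{x}. polya_weight (\<beta> z) (\<zeta> z))" for \<zeta>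
    by (simp add: weight_def prod.remove[of UNIV x])
  have "(\<Prod>z\<in>UNIV-{x}. polya_weight (\<beta> z) (add_at \<xi> x z)) = (\<Prod>z\<in>UNIV-{x}. polya_weight (\<beta> z) (\<xi> z))"
    by (intro prod.cong) auto
  with polya_weight_Suc[of "\<xi> x" "\<beta> x"] show ?thesis
    by (simp add: *[of "add_at \<xi> x"] *[of \<xi>])
qed

lemma msum_add: "msum \<beta> k (\<lambda>\<eta>. F \<eta> + G \<eta>) = msum \<beta> k F + msum \<beta> k G"
  by (simp add: msum_def algebra_simps sum.distrib)

lemma msum_diff: "msum \<beta> k (\<lambda>\<eta>. F \<eta> - G \<eta>) = msum \<beta> k F - msum \<beta> k G"
  by (simp add: msum_def algebra_simps sum_subtractf)

lemma msum_cmult: "msum \<beta> k (\<lambda>\<eta>. c * F \<eta>) = c * msum \<beta> k F"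
  by (simp add: msum_def sum_distrib_left algebra_simps)

lemma msum_sum: "msum \<beta> k (\<lambda>\<eta>. \<Sum>i\<in>A. F i \<eta>) = (\<Sum>i\<in>A. msum \<beta> k (F i))"
  by (simp add: msum_def sum_distrib_left sum.swap[of _ A])

lemma msum_cong: "(\<And>\<eta>. \<eta> \<in> configs k \<Longrightarrow> F \<eta> = G \<eta>) \<Longrightarrow> msum \<beta> k F = msum \<beta> k G"
  by (simp add: msum_def cong: sum.cong)

lemma msum_mono:
  "(\<And>x. \<beta> x \<ge> 0) \<Longrightarrow> (\<And>\<eta>. \<eta> \<in> configs k \<Longrightarrow> F \<eta> \<le> G \<eta>) \<Longrightarrow> msum \<beta> k F \<le> msum \<beta> k G"
  unfolding msum_def by (intro sum_mono mult_left_mono weight_nonneg) auto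

lemma msum_nonneg:
  "(\<And>x. \<beta> x \<ge> 0) \<Longrightarrow> (\<And>\<eta>. \<eta> \<in> configs k \<Longrightarrow> F \<eta> \<ge> 0) \<Longrightarrow> msum \<beta> k F \<ge> 0"
  unfolding msum_def by (intro sum_nonneg mult_nonneg_nonneg weight_nonneg) auto

text \<open>
  Size-biasing by the occupation number of \<open>x\<close> is the same as adding a particle at \<open>x\<close> at the urn
  rate \<open>\<beta> x + \<xi> x\<close>. Both the urn recursion and the reversibility of the jumps follow from this.
\<close>

lemma msum_mecke:
  "msum \<beta> (Suc k) (\<lambda>\<eta>. real (\<eta> x) * G \<eta>) =
   msum \<beta> k (\<lambda>\<xi>. (\<beta> x + real (\<xi> x)) * G (add_at \<xi> x))"
proof -
  have "msum \<beta> (Suc k) (\<lambda>\<eta>. real (\<eta> x) * G \<eta>) =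
      (\<Sum>\<eta>\<in>{\<eta>\<in>configs (Suc k). \<eta> x > 0}. weight \<beta> \<eta> * (real (\<eta> x) * G \<eta>))"
    unfolding msum_def by (rule sum.mono_neutral_right) auto
  also have "\<dots> = (\<Sum>\<xi>\<in>configs k. weight \<beta> (add_at \<xi> x) * (real (Suc (\<xi> x)) * G (add_at \<xi> x)))"
  proof (rule sum.reindex_bij_witness[of _ "\<lambda>\<xi>. add_at \<xi> x" "\<lambda>\<eta>. \<eta>(x := \<eta> x - 1)"])
    fix \<eta> assume \<eta>: "\<eta> \<in> {\<eta> \<in> configs (Suc k). 0 < \<eta> x}"
    then show 1: "add_at (\<eta>(x := \<eta> x - 1)) x = \<eta>" by (auto simp: add_at_def)
    show "\<eta>(x := \<eta> x - 1) \<in> configs k"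
      using \<eta> unfolding add_at_configs_iff[of "\<eta>(x := \<eta> x - 1)" x k, symmetric] 1 by simp
    show "weight \<beta> (add_at (\<eta>(x := \<eta> x - 1)) x) *
       (real (Suc ((\<eta>(x := \<eta> x - 1)) x)) * G (add_at (\<eta>(x := \<eta> x - 1)) x)) =
       weight \<beta> \<eta> * (real (\<eta> x) * G \<eta>)"
      unfolding 1 using \<eta> by simp
  qed (simp_all add: add_at_remove)
  also have "\<dots> = msum \<beta> k (\<lambda>\<xi>. (\<beta> x + real (\<xi> x)) * G (add_at \<xi> x))"
    unfolding msum_def
  proof (rule sum.cong[OF refl])
    fix \<xi> :: "'a \<Rightarrow> nat"
    have "weight \<beta> (add_at \<xi> x) * (real (Suc (\<xi> x)) * G (add_at \<xi> x))
       = (real (Suc (\<xi> x)) * weight \<beta> (add_at \<xi> x)) * G (add_at \<xi> x)" by (simp only: mult_ac)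
    then show "weight \<beta> (add_at \<xi> x) * (real (Suc (\<xi> x)) * G (add_at \<xi> x))
       = weight \<beta> \<xi> * ((\<beta> x + real (\<xi> x)) * G (add_at \<xi> x))"
      unfolding weight_add_at by (simp only: mult_ac)
  qed
  finally show ?thesis .
qed

text \<open>
  The last draw of the urn, obtained by summing the previous identity over all sites. It makes
  induction on the number of particles possible without ever enumerating configurations.
\<close>

lemma msum_polya:
  "real (Suc k) * msum \<beta> (Suc k) F = msum \<beta> k (\<lambda>\<xi>. \<Sum>x\<in>UNIV. (\<beta> x + real (\<xi> x)) * F (add_at \<xi> x))"
proof -
  have "real (Suc k) * msum \<beta> (Suc k) F = msum \<beta> (Suc k) (\<lambda>\<eta>. \<Sum>x\<in>UNIV. real (\<eta> x) * F \<eta>)"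
    unfolding msum_cmult[symmetric]
    by (rule msum_cong) (auto simp: configs_def sum_distrib_right[symmetric] simp flip: of_nat_sum of_nat_Suc)
  then show ?thesis by (simp only: msum_sum msum_mecke)
qed

lemma weighted_square_decomposition:
  fixes b G :: "'a::finite \<Rightarrow> real"
  assumes S: "S = sum b UNIV" "S > 0"
  shows "(\<Sum>x\<in>UNIV. b x * (G x)\<^sup>2) = S * ((\<Sum>x\<in>UNIV. b x * G x) / S)\<^sup>2
           + (\<Sum>x\<in>UNIV. \<Sum>y\<in>UNIV. b x * b y * (G x - G y)\<^sup>2) / (2 * S)"
proof -
  have "(\<Sum>x\<in>UNIV. \<Sum>y\<in>UNIV. b x * b y * (G x - G y)\<^sup>2)
     = (\<Sum>x\<in>UNIV. \<Sum>y\<in>UNIV. (b x * (G x)\<^sup>2) * b y) + (\<Sum>x\<in>UNIV. \<Sum>y\<in>UNIV. b x * (b y * (G y)\<^sup>2))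
       - 2 * (\<Sum>x\<in>UNIV. \<Sum>y\<in>UNIV. (b x * G x) * (b y * G y))"
    by (simp add: sum_distrib_left power2_eq_square algebra_simps flip: sum.distrib sum_subtractf)
  also have "\<dots> = 2 * S * (\<Sum>x\<in>UNIV. b x * (G x)\<^sup>2) - 2 * (\<Sum>x\<in>UNIV. b x * G x)\<^sup>2"
    by (simp add: S power2_eq_square flip: sum_product)
  finally show ?thesis using S(2) by (simp add: field_simps power2_eq_square)
qed

lemma sum_weights_configs:
  "\<xi> \<in> configs k \<Longrightarrow> (\<Sum>x\<in>UNIV. \<beta> x + real (\<xi> x)) = sum \<beta> UNIV + real k"
  by (auto simp: configs_def sum.distrib simp flip: of_nat_sum)

text \<open>
  The second moment conditioned on the first \<open>k\<close> draws: the square of the conditional mean plus the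
  conditional variance of the last draw. Iterating it reduces variance bounds to a
  bound on the fluctuations of a single draw.
\<close>

lemma msum_square_decomposition:
  fixes \<beta> :: "'a::finite \<Rightarrow> real"
  assumes S: "S = sum \<beta> UNIV + real k" "S > 0"
  shows "real (Suc k) * msum \<beta> (Suc k) (\<lambda>\<eta>. (F \<eta>)\<^sup>2) =
     S * msum \<beta> k (\<lambda>\<xi>. (polya_mean \<beta> F \<xi>)\<^sup>2)
     + msum \<beta> k (\<lambda>\<xi>. \<Sum>x\<in>UNIV. \<Sum>y\<in>UNIV. (\<beta> x + real (\<xi> x)) * (\<beta> y + real (\<xi> y)) *
                         (F (add_at \<xi> x) - F (add_at \<xi> y))\<^sup>2) / (2 * S)"
    (is "_ = _ + msum \<beta> k ?E / _")
proof -
  have "real (Suc k) * msum \<beta> (Suc k) (\<lambda>\<eta>. (F \<eta>)\<^sup>2)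
      = msum \<beta> k (\<lambda>\<xi>. S * (polya_mean \<beta> F \<xi>)\<^sup>2 + (1 / (2 * S)) * ?E \<xi>)"
    unfolding msum_polya
  proof (rule msum_cong)
    fix \<xi> :: "'a \<Rightarrow> nat" assume "\<xi> \<in> configs k"
    with S(1) have *: "S = (\<Sum>x\<in>UNIV. \<beta> x + real (\<xi> x))" by (simp add: sum_weights_configs)
    show "(\<Sum>x\<in>UNIV. (\<beta> x + real (\<xi> x)) * (F (add_at \<xi> x))\<^sup>2)
        = S * (polya_mean \<beta> F \<xi>)\<^sup>2 + (1 / (2 * S)) * ?E \<xi>"
      unfolding polya_mean_def *[symmetric]
      by (subst weighted_square_decomposition[OF * S(2)]) simp
  qed
  then show ?thesis unfolding msum_add msum_cmult by simp
qed

section \<open>The Poincare inequality for two sites\<close>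

lemma two_site_polya:
  "real (Suc n) * (\<Sum>i\<le>Suc n. polya_weight a i * polya_weight b (Suc n - i) * F i) =
   (\<Sum>i\<le>n. polya_weight a i * polya_weight b (n - i) *
      ((a + real i) * F (Suc i) + (b + real (n - i)) * F i))"
proof -
  let ?w = "polya_weight a" and ?v = "polya_weight b"
  have "real (Suc n) * (\<Sum>i\<le>Suc n. ?w i * ?v (Suc n - i) * F i)
      = (\<Sum>i\<le>Suc n. real i * ?w i * ?v (Suc n - i) * F i)
        + (\<Sum>i\<le>Suc n. ?w i * (real (Suc n - i) * ?v (Suc n - i)) * F i)"
    unfolding sum_distrib_left sum.distrib[symmetric]
    by (intro sum.cong) (auto simp: of_nat_diff algebra_simps)
  also have "(\<Sum>i\<le>Suc n. real i * ?w i * ?v (Suc n - i) * F i)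
      = (\<Sum>i\<le>n. (real (Suc i) * ?w (Suc i)) * ?v (n - i) * F (Suc i))"
    by (subst sum.atMost_Suc_shift) simp
  also have "\<dots> = (\<Sum>i\<le>n. ?w i * ?v (n - i) * ((a + real i) * F (Suc i)))"
    unfolding polya_weight_Suc by (simp only: mult_ac)
  also have "(\<Sum>i\<le>Suc n. ?w i * (real (Suc n - i) * ?v (Suc n - i)) * F i)
      = (\<Sum>i\<le>n. ?w i * (real (Suc (n - i)) * ?v (Suc (n - i))) * F i)"
    by (simp add: Suc_diff_le algebra_simps)
  also have "\<dots> = (\<Sum>i\<le>n. ?w i * ?v (n - i) * ((b + real (n - i)) * F i))"
    unfolding polya_weight_Suc by (simp only: mult_ac)
  finally show ?thesis by (simp only: sum.distrib distrib_left)
qed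

lemma two_point_square:
  fixes p q :: real
  assumes "p + q > 0"
  shows "p * u\<^sup>2 + q * v\<^sup>2 = (p + q) * ((p * u + q * v) / (p + q))\<^sup>2 + p * q * (u - v)\<^sup>2 / (p + q)"
proof -
  define S where "S = p + q"
  have S: "S \<noteq> 0" using assms by (simp add: S_def)
  have "S * (p * u\<^sup>2 + q * v\<^sup>2) = (p * u + q * v)\<^sup>2 + p * q * (u - v)\<^sup>2"
    by (simp add: S_def power2_eq_square algebra_simps)
  then have "p * u\<^sup>2 + q * v\<^sup>2 = ((p * u + q * v)\<^sup>2 + p * q * (u - v)\<^sup>2) / S"
    using S by (simp add: eq_divide_eq mult.commute)
  moreover have "S * (N / S)\<^sup>2 = N\<^sup>2 / S" for N
    using S by (simp add: power_divide power2_eq_square)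
  ultimately show ?thesis
    unfolding S_def[symmetric] by (metis add_divide_distrib)
qed

text \<open>
  Averaging over the last draw
  replaces \<open>g\<close> by \<open>h\<close>; the increments of \<open>h\<close> are convex combinations, up to a factor, of neighbouring
  increments of \<open>g\<close>, so the energy contracts by Jensen's inequality, while the variance lost is exactly a
  multiple of the energy of \<open>g\<close>. The two contributions add up to the optimal constant \<open>a + b\<close> without any loss, which is
  why the inequality is uniform in the number \<open>n\<close> of particles.
\<close>

lemma two_site_poincare:
  assumes ab: "a > 0" "b > 0"
  shows "\<exists>c. (a + b) * (\<Sum>i\<le>n. polya_weight a i * polya_weight b (n - i) * (g i - c)\<^sup>2)
     \<le> (\<Sum>i<n. polya_weight a i * (a + real i) * (polya_weight b (n - 1 - i) * (b + real (n - 1 - i))) *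
           (g (Suc i) - g i)\<^sup>2)"
proof (induction n arbitrary: g)
  case 0
  then show ?case by (intro exI[of _ "g 0"]) simp
next
  case (Suc n)
  define s where "s = a + b + real n"
  define p where "p i = a + real i" for i
  define q where "q i = b + real (n - i)" for i
  define W where "W i = polya_weight a i * polya_weight b (n - i)" for i
  define \<kappa> where "\<kappa> i = polya_weight a i * (a + real i) * (polya_weight b (n - i) * (b + real (n - i)))" for i
  define d where "d i = (g (Suc i) - g i)\<^sup>2" for i
  define h where "h i = (p i * g (Suc i) + q i * g i) / s" for i
  define D where "D = (\<Sum>i\<le>n. \<kappa> i * d i)"
  have s: "s > 0" using ab by (simp add: s_def add_pos_nonneg)
  have sh: "s * h i = p i * g (Suc i) + q i * g i" for i using s by (simp add: h_def)
  have pq: "p i + q i = s" if "i \<le> n" for i using that by (simp add: p_def q_def s_def of_nat_diff)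
  have \<kappa>: "\<kappa> i = W i * (p i * q i)" for i by (simp add: \<kappa>_def W_def p_def q_def)
  obtain c where c: "(a + b) * (\<Sum>i\<le>n. W i * (h i - c)\<^sup>2)
     \<le> (\<Sum>i<n. polya_weight a i * (a + real i) * (polya_weight b (n - 1 - i) * (b + real (n - 1 - i))) *
           (h (Suc i) - h i)\<^sup>2)" (is "_ \<le> ?R")
    using Suc.IH[of h] unfolding W_def by blast
  \<comment> \<open>The energy of \<open>h\<close> on \<open>n\<close> particles contracts against that of \<open>g\<close> on \<open>n + 1\<close>: each increment of \<open>h\<close>
    is \<open>(s + 1) / s\<close> times a convex combination of two increments of \<open>g\<close>.\<close>
  have "?R \<le> (\<Sum>i<n. (s + 1) / s\<^sup>2 * (real (Suc i) * \<kappa> (Suc i) * d (Suc i) + real (n - i) * \<kappa> i * d i))"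
  proof (rule sum_mono)
    fix i assume "i \<in> {..<n}"
    then have i: "i < n" by simp
    then have ni: "n - i = Suc (n - 1 - i)" "n - Suc i = n - 1 - i" by auto
    let ?m = "polya_weight a i * (a + real i) * (polya_weight b (n - 1 - i) * (b + real (n - 1 - i)))"
    define p' where "p' = p (Suc i)"
    have m: "?m \<ge> 0" using ab by (intro mult_nonneg_nonneg polya_weight_nonneg) auto
    have e: "p' + q i = s + 1" using i by (simp add: p'_def p_def q_def s_def of_nat_diff)
    have q1: "q (Suc i) = q i - 1" "p (Suc i) = p i + 1" using i by (auto simp: q_def p_def of_nat_diff)
    have "s * (h (Suc i) - h i) = p' * (g (Suc (Suc i)) - g (Suc i)) + q i * (g (Suc i) - g i)"
      unfolding right_diff_distrib sh p'_def q1 by (simp add: algebra_simps)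
    then have "h (Suc i) - h i = (p' * (g (Suc (Suc i)) - g (Suc i)) + q i * (g (Suc i) - g i)) / s"
      using s by (simp add: field_simps)
    moreover have "(p' * u + q i * v)\<^sup>2 \<le> (s + 1) * (p' * u\<^sup>2 + q i * v\<^sup>2)" for u v
    proof -
      have "0 \<le> p' * q i * (u - v)\<^sup>2" using ab by (auto simp: p'_def p_def q_def)
      then show ?thesis unfolding e[symmetric] by (simp add: power2_eq_square algebra_simps)
    qed
    ultimately have "(h (Suc i) - h i)\<^sup>2 \<le> (s + 1) / s\<^sup>2 * (p' * d (Suc i) + q i * d i)"
      using s by (simp add: d_def power_divide divide_right_mono)
    then have "?m * (h (Suc i) - h i)\<^sup>2 \<le> ?m * ((s + 1) / s\<^sup>2 * (p' * d (Suc i) + q i * d i))"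
      using m by (rule mult_left_mono)
    also have "\<dots> = (s + 1) / s\<^sup>2 * ((?m * p') * d (Suc i) + (?m * q i) * d i)"
      by (simp add: algebra_simps)
    also have "?m * p' = (polya_weight b (n - 1 - i) * (b + real (n - 1 - i))) *
        (a + real (Suc i)) * ((a + real i) * polya_weight a i)"
      by (simp only: p'_def p_def mult_ac)
    also have "\<dots> = real (Suc i) * \<kappa> (Suc i)"
      unfolding polya_weight_Suc[symmetric] by (simp only: \<kappa>_def ni(2) mult_ac)
    also have "?m * q i = (polya_weight a i * (a + real i)) * (b + real (n - i)) *
        ((b + real (n - 1 - i)) * polya_weight b (n - 1 - i))"
      by (simp only: q_def mult_ac)
    also have "\<dots> = real (n - i) * \<kappa> i"
      unfolding polya_weight_Suc[symmetric] ni(1)[symmetric] by (simp only: \<kappa>_def mult_ac)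
    finally show "?m * (h (Suc i) - h i)\<^sup>2
      \<le> (s + 1) / s\<^sup>2 * (real (Suc i) * \<kappa> (Suc i) * d (Suc i) + real (n - i) * \<kappa> i * d i)" .
  qed
  also have "\<dots> = (s + 1) / s\<^sup>2 * ((\<Sum>i<n. real (Suc i) * \<kappa> (Suc i) * d (Suc i)) + (\<Sum>i<n. real (n - i) * \<kappa> i * d i))"
    by (simp only: sum.distrib sum_distrib_left distrib_left)
  also have "(\<Sum>i<n. real (Suc i) * \<kappa> (Suc i) * d (Suc i)) = (\<Sum>i\<le>n. real i * \<kappa> i * d i)"
    unfolding lessThan_Suc_atMost[symmetric] sum.lessThan_Suc_shift by simp
  also have "(\<Sum>i<n. real (n - i) * \<kappa> i * d i) = (\<Sum>i\<le>n. real (n - i) * \<kappa> i * d i)"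
    unfolding lessThan_Suc_atMost[symmetric] sum.lessThan_Suc by simp
  \<comment> \<open>The increment of \<open>g\<close> at \<open>i\<close> enters those of \<open>h\<close> at \<open>i - 1\<close> and \<open>i\<close>, with total weight \<open>n\<close>.\<close>
  also have "(\<Sum>i\<le>n. real i * \<kappa> i * d i) + (\<Sum>i\<le>n. real (n - i) * \<kappa> i * d i) = real n * D"
    unfolding D_def sum_distrib_left sum.distrib[symmetric]
    by (intro sum.cong) (auto simp: of_nat_diff algebra_simps)
  finally have IH: "(a + b) * (\<Sum>i\<le>n. W i * (h i - c)\<^sup>2) \<le> (s + 1) / s\<^sup>2 * (real n * D)"
    using c by linarith
  define X where "X = (\<Sum>i\<le>Suc n. polya_weight a i * polya_weight b (Suc n - i) * (g i - c)\<^sup>2)"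
  define Y where "Y = (\<Sum>i\<le>n. W i * (h i - c)\<^sup>2)"
  have "real (Suc n) * (\<Sum>i\<le>Suc n. polya_weight a i * polya_weight b (Suc n - i) * (g i - c)\<^sup>2)
      = (\<Sum>i\<le>n. s * (W i * (h i - c)\<^sup>2) + \<kappa> i * d i / s)"
    unfolding two_site_polya
  proof (rule sum.cong[OF refl])
    fix i assume "i \<in> {..n}"
    then have pqi: "p i + q i = s" by (simp add: pq)
    have "p i * (g (Suc i) - c)\<^sup>2 + q i * (g i - c)\<^sup>2
        = s * ((p i * (g (Suc i) - c) + q i * (g i - c)) / s)\<^sup>2 + p i * q i * ((g (Suc i) - c) - (g i - c))\<^sup>2 / s"
      using two_point_square[of "p i" "q i"] s unfolding pqi by simp
    also have "(p i * (g (Suc i) - c) + q i * (g i - c)) / s = h i - c"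
    proof -
      have "p i * (g (Suc i) - c) + q i * (g i - c) = s * (h i - c)"
        unfolding right_diff_distrib sh by (simp add: pqi[symmetric] algebra_simps)
      then show ?thesis using s by simp
    qed
    finally have "p i * (g (Suc i) - c)\<^sup>2 + q i * (g i - c)\<^sup>2 = s * (h i - c)\<^sup>2 + p i * q i * d i / s"
      by (simp add: d_def)
    then show "polya_weight a i * polya_weight b (n - i) *
         ((a + real i) * (g (Suc i) - c)\<^sup>2 + (b + real (n - i)) * (g i - c)\<^sup>2)
      = s * (W i * (h i - c)\<^sup>2) + \<kappa> i * d i / s"
      unfolding p_def[symmetric] q_def[symmetric] W_def[symmetric] \<kappa> by (simp add: algebra_simps)
  qed
  also have "\<dots> = s * (\<Sum>i\<le>n. W i * (h i - c)\<^sup>2) + D / s"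
    by (simp add: sum.distrib D_def sum_distrib_left sum_divide_distrib)
  finally have X: "real (Suc n) * X = s * Y + D / s" unfolding X_def Y_def .
  have "real (Suc n) * ((a + b) * X) = (a + b) * (real (Suc n) * X)" by (simp only: mult_ac)
  also have "\<dots> = s * ((a + b) * Y) + (a + b) * D / s"
    unfolding X by (simp add: distrib_left)
  also have "\<dots> \<le> s * ((s + 1) / s\<^sup>2 * (real n * D)) + (a + b) * D / s"
    using IH s unfolding Y_def[symmetric] by (intro add_right_mono mult_left_mono) auto
  also have "\<dots> = D * ((s + 1) * real n + (a + b)) / s"
    using s by (simp add: field_simps power2_eq_square)
  also have "(s + 1) * real n + (a + b) = s * real (Suc n)" by (simp add: s_def algebra_simps)
  also have "D * (s * real (Suc n)) / s = real (Suc n) * D" using s by (simp only: mult_ac) simp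
  finally have "(a + b) * X \<le> D"
    by (simp only: mult_le_cancel_left_pos of_nat_0_less_iff zero_less_Suc)
  then show ?case
    unfolding D_def \<kappa>_def d_def X_def by (intro exI[of _ c]) (simp only: lessThan_Suc_atMost diff_Suc_1)
qed

section \<open>Conditioning on all sites but two\<close>

text \<open>
  A canonical representative of all configurations that differ only in how the particles on \<open>u\<close> and
  \<open>v\<close> are divided between these two sites: a function of \<open>gather u v \<eta>\<close> is one that cannot see this division.
\<close>

definition gather :: "'a \<Rightarrow> 'a \<Rightarrow> ('a \<Rightarrow> nat) \<Rightarrow> 'a \<Rightarrow> nat" where
  "gather u v \<eta> = \<eta>(u := \<eta> u + \<eta> v, v := 0)"

definition pair_energy :: "('a::finite \<Rightarrow> real) \<Rightarrow> nat \<Rightarrow> (('a \<Rightarrow> nat) \<Rightarrow> real) \<Rightarrow> 'a \<Rightarrow> 'a \<Rightarrow> real" where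
  "pair_energy \<alpha> k f x y =
     msum \<alpha> k (\<lambda>\<eta>. real (\<eta> x) * (\<alpha> y + real (\<eta> y)) * (f (move x y \<eta>) - f \<eta>)\<^sup>2)"

lemma sum_two_sites:
  assumes "u \<noteq> v"
  shows "sum (\<eta> :: 'a::finite \<Rightarrow> nat) UNIV = \<eta> u + \<eta> v + sum \<eta> (UNIV - {u, v})"
proof -
  have "sum \<eta> UNIV = \<eta> u + sum \<eta> (UNIV - {u})" by (simp add: sum.remove)
  also have "sum \<eta> (UNIV - {u}) = \<eta> v + sum \<eta> (UNIV - {u} - {v})" using assms by (simp add: sum.remove)
  also have "UNIV - {u} - {v} = UNIV - {u, v}" by auto
  finally show ?thesis by simp
qed

lemma configs_two_sites_iff:
  assumes "u \<noteq> v" "\<zeta> \<in> configs k" "i + j = \<zeta> u + \<zeta> v"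
  shows "\<zeta>(u := i, v := j) \<in> configs k"
proof -
  have "sum (\<zeta>(u := i, v := j)) (UNIV - {u, v}) = sum \<zeta> (UNIV - {u, v})"
    by (intro sum.cong) auto
  then show ?thesis
    using assms by (auto simp: configs_def sum_two_sites[OF assms(1)])
qed

lemma msum_fibres:
  fixes \<alpha> :: "'a::finite \<Rightarrow> real"
  assumes "u \<noteq> v"
  shows "msum \<alpha> k F = (\<Sum>\<zeta>\<in>{\<zeta>\<in>configs k. \<zeta> v = 0}.
     (\<Prod>z\<in>UNIV-{u,v}. polya_weight (\<alpha> z) (\<zeta> z)) *
     (\<Sum>i\<le>\<zeta> u. polya_weight (\<alpha> u) i * polya_weight (\<alpha> v) (\<zeta> u - i) * F (\<zeta>(u := i, v := \<zeta> u - i))))"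
proof -
  let ?R = "\<lambda>\<zeta>. \<Prod>z\<in>UNIV-{u,v}. polya_weight (\<alpha> z) (\<zeta> z)"
  have w: "weight \<alpha> \<eta> = ?R \<eta> * (polya_weight (\<alpha> u) (\<eta> u) * polya_weight (\<alpha> v) (\<eta> v))" for \<eta>
  proof -
    have "weight \<alpha> \<eta> = polya_weight (\<alpha> u) (\<eta> u) * (\<Prod>z\<in>UNIV-{u}. polya_weight (\<alpha> z) (\<eta> z))"
      by (simp add: weight_def prod.remove)
    also have "(\<Prod>z\<in>UNIV-{u}. polya_weight (\<alpha> z) (\<eta> z)) = polya_weight (\<alpha> v) (\<eta> v) * (\<Prod>z\<in>UNIV-{u}-{v}. polya_weight (\<alpha> z) (\<eta> z))"
      using assms by (intro prod.remove) auto
    also have "UNIV - {u} - {v} = UNIV - {u, v}" by auto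
    finally show ?thesis by (simp add: mult_ac)
  qed
  have R: "?R (\<zeta>(u := i, v := j)) = ?R \<zeta>" for \<zeta> i j by (intro prod.cong) auto
  have "(\<Sum>\<zeta>\<in>{\<zeta>\<in>configs k. \<zeta> v = 0}. ?R \<zeta> *
     (\<Sum>i\<le>\<zeta> u. polya_weight (\<alpha> u) i * polya_weight (\<alpha> v) (\<zeta> u - i) * F (\<zeta>(u := i, v := \<zeta> u - i))))
    = (\<Sum>(\<zeta>, i)\<in>(SIGMA \<zeta>:{\<zeta>\<in>configs k. \<zeta> v = 0}. {..\<zeta> u}).
        weight \<alpha> (\<zeta>(u := i, v := \<zeta> u - i)) * F (\<zeta>(u := i, v := \<zeta> u - i)))"
    using assms by (subst sum.Sigma[symmetric]) (auto simp: w R sum_distrib_left mult_ac)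
  also have "\<dots> = msum \<alpha> k F"
    unfolding msum_def
  proof (rule sum.reindex_bij_witness[of _ "\<lambda>\<eta>. (gather u v \<eta>, \<eta> u)" "\<lambda>(\<zeta>, i). \<zeta>(u := i, v := \<zeta> u - i)"],
      goal_cases)
    case (1 p)
    then show ?case using assms by (auto simp: gather_def fun_eq_iff)
  next
    case (2 p)
    then show ?case using assms by (auto intro!: configs_two_sites_iff)
  next
    case (3 \<eta>)
    then show ?case using assms by (auto simp: gather_def fun_eq_iff)
  next
    case (4 \<eta>)
    then show ?case using assms by (auto simp: gather_def intro!: configs_two_sites_iff)
  next
    case (5 p)
    then show ?case by auto
  qed
  finally show ?thesis by simp
qed

text \<open>
  Conditionally on the other sites and on the total number of particles on \<open>u\<close> and \<open>v\<close>, these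
  particles form a two-site system, so the two-site inequality applies on every fibre of \<open>gather u v\<close>.
  The function \<open>c\<close> collects the centring constants of the fibres.
\<close>

lemma pair_poincare:
  fixes \<alpha> :: "'a::finite \<Rightarrow> real"
  assumes uv: "u \<noteq> v" and \<alpha>: "\<And>x. \<alpha> x > 0"
  shows "\<exists>c. (\<alpha> u + \<alpha> v) * msum \<alpha> k (\<lambda>\<eta>. (f \<eta> - c (gather u v \<eta>))\<^sup>2) \<le> pair_energy \<alpha> k f u v"
proof -
  let ?g = "\<lambda>\<zeta> i. f (\<zeta>(u := i, v := \<zeta> u - i))"
  let ?w = "polya_weight (\<alpha> u)" and ?v = "polya_weight (\<alpha> v)"
  have "\<forall>\<zeta>. \<exists>c. (\<alpha> u + \<alpha> v) * (\<Sum>i\<le>\<zeta> u. ?w i * ?v (\<zeta> u - i) * (?g \<zeta> i - c)\<^sup>2)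
     \<le> (\<Sum>i<\<zeta> u. ?w i * (\<alpha> u + real i) * (?v (\<zeta> u - 1 - i) * (\<alpha> v + real (\<zeta> u - 1 - i))) *
           (?g \<zeta> (Suc i) - ?g \<zeta> i)\<^sup>2)"
    (is "\<forall>\<zeta>. \<exists>c. ?P \<zeta> c")
  proof
    fix \<zeta> :: "'a \<Rightarrow> nat"
    show "\<exists>c. ?P \<zeta> c"
      by (rule two_site_poincare[OF \<alpha> \<alpha>, where g = "?g \<zeta>"])
  qed
  from choice[OF this] obtain c where "\<forall>\<zeta>. ?P \<zeta> (c \<zeta>)" by (rule exE)
  then have c: "\<And>\<zeta>. (\<alpha> u + \<alpha> v) * (\<Sum>i\<le>\<zeta> u. ?w i * ?v (\<zeta> u - i) * (?g \<zeta> i - c \<zeta>)\<^sup>2)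
     \<le> (\<Sum>i<\<zeta> u. ?w i * (\<alpha> u + real i) * (?v (\<zeta> u - 1 - i) * (\<alpha> v + real (\<zeta> u - 1 - i))) *
           (?g \<zeta> (Suc i) - ?g \<zeta> i)\<^sup>2)"
    by (rule spec)
  let ?R = "\<lambda>\<zeta>. \<Prod>z\<in>UNIV-{u,v}. polya_weight (\<alpha> z) (\<zeta> z)"
  have R: "?R \<zeta> \<ge> 0" for \<zeta> :: "'a \<Rightarrow> nat"
    using \<alpha> by (intro prod_nonneg polya_weight_nonneg) (auto intro: less_imp_le)
  have "(\<alpha> u + \<alpha> v) * msum \<alpha> k (\<lambda>\<eta>. (f \<eta> - c (gather u v \<eta>))\<^sup>2)
     = (\<Sum>\<zeta>\<in>{\<zeta>\<in>configs k. \<zeta> v = 0}. ?R \<zeta> *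
          ((\<alpha> u + \<alpha> v) * (\<Sum>i\<le>\<zeta> u. ?w i * ?v (\<zeta> u - i) * (?g \<zeta> i - c \<zeta>)\<^sup>2)))"
    unfolding msum_fibres[OF uv]
  proof (subst sum_distrib_left, rule sum.cong[OF refl])
    fix \<zeta> assume "\<zeta> \<in> {\<zeta> \<in> configs k. \<zeta> v = 0}"
    then have "gather u v (\<zeta>(u := i, v := \<zeta> u - i)) = \<zeta>" if "i \<le> \<zeta> u" for i
      using uv that by (auto simp: gather_def fun_eq_iff)
    then have "(\<Sum>i\<le>\<zeta> u. ?w i * ?v (\<zeta> u - i) * (?g \<zeta> i - c (gather u v (\<zeta>(u := i, v := \<zeta> u - i))))\<^sup>2)
       = (\<Sum>i\<le>\<zeta> u. ?w i * ?v (\<zeta> u - i) * (?g \<zeta> i - c \<zeta>)\<^sup>2)" by simp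
    then show "(\<alpha> u + \<alpha> v) * (?R \<zeta> * (\<Sum>i\<le>\<zeta> u. ?w i * ?v (\<zeta> u - i) * (?g \<zeta> i - c (gather u v (\<zeta>(u := i, v := \<zeta> u - i))))\<^sup>2))
       = ?R \<zeta> * ((\<alpha> u + \<alpha> v) * (\<Sum>i\<le>\<zeta> u. ?w i * ?v (\<zeta> u - i) * (?g \<zeta> i - c \<zeta>)\<^sup>2))"
      by (simp only: mult.left_commute)
  qed
  also have "\<dots> \<le> (\<Sum>\<zeta>\<in>{\<zeta>\<in>configs k. \<zeta> v = 0}. ?R \<zeta> *
     (\<Sum>i<\<zeta> u. ?w i * (\<alpha> u + real i) * (?v (\<zeta> u - 1 - i) * (\<alpha> v + real (\<zeta> u - 1 - i))) *
           (?g \<zeta> (Suc i) - ?g \<zeta> i)\<^sup>2))"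
    by (intro sum_mono mult_left_mono c R)
  also have "\<dots> = pair_energy \<alpha> k f u v"
    unfolding pair_energy_def msum_fibres[OF uv]
  proof (rule sum.cong[OF refl])
    fix \<zeta> assume "\<zeta> \<in> {\<zeta> \<in> configs k. \<zeta> v = 0}"
    let ?n = "\<zeta> u"
    let ?\<eta> = "\<lambda>i. \<zeta>(u := i, v := ?n - i)"
    let ?t = "\<lambda>i. ?w i * ?v (?n - i) * (real (?\<eta> i u) * (\<alpha> v + real (?\<eta> i v)) * (f (move u v (?\<eta> i)) - f (?\<eta> i))\<^sup>2)"
    have "(\<Sum>i\<le>?n. ?t i) = (\<Sum>i<?n. ?t (Suc i))"
      using uv by (simp only: lessThan_Suc_atMost[symmetric] sum.lessThan_Suc_shift) simp
    also have "\<dots> = (\<Sum>i<?n. ?w i * (\<alpha> u + real i) * (?v (?n - 1 - i) * (\<alpha> v + real (?n - 1 - i))) *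
           (?g \<zeta> (Suc i) - ?g \<zeta> i)\<^sup>2)"
    proof (rule sum.cong[OF refl])
      fix i assume "i \<in> {..<?n}"
      then have "move u v (?\<eta> (Suc i)) = ?\<eta> i"
        using uv by (auto simp: move_def fun_eq_iff)
      then have "?t (Suc i) = (real (Suc i) * ?w (Suc i)) * (?v (?n - 1 - i) * (\<alpha> v + real (?n - 1 - i))) *
           (?g \<zeta> i - ?g \<zeta> (Suc i))\<^sup>2"
        using uv by (simp add: mult_ac del: of_nat_Suc)
      also have "\<dots> = ?w i * (\<alpha> u + real i) * (?v (?n - 1 - i) * (\<alpha> v + real (?n - 1 - i))) *
           (?g \<zeta> (Suc i) - ?g \<zeta> i)\<^sup>2"
        unfolding polya_weight_Suc by (simp only: power2_commute mult_ac)
      finally show "?t (Suc i) = \<dots>" .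
    qed
    finally show "?R \<zeta> * (\<Sum>i<?n. ?w i * (\<alpha> u + real i) * (?v (?n - 1 - i) * (\<alpha> v + real (?n - 1 - i))) *
           (?g \<zeta> (Suc i) - ?g \<zeta> i)\<^sup>2) = ?R \<zeta> * (\<Sum>i\<le>?n. ?t i)" by (simp only:)
  qed
  finally show ?thesis by (rule exI[of _ c])
qed

section \<open>Splitting sites and comparing with indifferent functions\<close>

text \<open>
  Every site \<open>v\<close> is cut into a slot \<open>(v, True)\<close> and a remainder \<open>(v, False)\<close> among which its weight is
  distributed. Adding up the counts of both recovers the original urn; giving all slots the same weight
  makes them exchangeable even though the sites themselves are not.
\<close>

definition unsplit :: "('v \<times> bool \<Rightarrow> nat) \<Rightarrow> 'v \<Rightarrow> nat" where
  "unsplit \<eta> v = \<eta> (v, True) + \<eta> (v, False)"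

definition splits :: "('v \<times> bool \<Rightarrow> real) \<Rightarrow> ('v \<Rightarrow> real) \<Rightarrow> bool" where
  "splits \<beta> \<alpha> \<longleftrightarrow> (\<forall>v. \<beta> (v, True) + \<beta> (v, False) = \<alpha> v)"

lemma sum_pairs:
  "(\<Sum>p\<in>(UNIV :: ('v::finite \<times> bool) set). g p) = (\<Sum>v\<in>UNIV. g (v, True) + g (v, False))"
proof -
  have "(\<Sum>p\<in>(UNIV :: ('v \<times> bool) set). g p) = (\<Sum>v\<in>UNIV. \<Sum>b\<in>UNIV. g (v, b))"
    by (simp add: sum.cartesian_product)
  then show ?thesis by (simp add: UNIV_bool add.commute)
qed

lemma unsplit_add_at: "unsplit (add_at \<xi> p) = add_at (unsplit \<xi>) (fst p)"
  by (cases p, cases "snd p") (auto simp: unsplit_def add_at_def fun_eq_iff)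

lemma sum_split_weights:
  fixes \<xi> :: "'v::finite \<times> bool \<Rightarrow> nat"
  assumes "splits \<beta> \<alpha>"
  shows "(\<Sum>p\<in>UNIV. (\<beta> p + real (\<xi> p)) * g (fst p)) = (\<Sum>v\<in>UNIV. (\<alpha> v + real (unsplit \<xi> v)) * g v)"
  unfolding sum_pairs
proof (rule sum.cong[OF refl])
  fix v
  have "\<alpha> v = \<beta> (v, True) + \<beta> (v, False)" using assms by (simp add: splits_def)
  then show "(\<beta> (v, True) + real (\<xi> (v, True))) * g (fst (v, True)) +
      (\<beta> (v, False) + real (\<xi> (v, False))) * g (fst (v, False)) = (\<alpha> v + real (unsplit \<xi> v)) * g v"
    by (simp add: unsplit_def algebra_simps)
qed

text \<open>
  The chance of drawing a site is the sum of the chances of drawing its two parts, and this remains true after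
  every draw.
\<close>

lemma msum_unsplit:
  fixes \<alpha> :: "'v::finite \<Rightarrow> real"
  assumes \<beta>: "splits \<beta> \<alpha>"
  shows "msum \<beta> k (\<lambda>\<eta>. F (unsplit \<eta>)) = msum \<alpha> k F"
proof (induction k arbitrary: F)
  case 0
  show ?case by (simp add: msum_def configs_0 weight_def unsplit_def)
next
  case (Suc k)
  have "real (Suc k) * msum \<beta> (Suc k) (\<lambda>\<eta>. F (unsplit \<eta>))
      = msum \<beta> k (\<lambda>\<xi>. \<Sum>v\<in>UNIV. (\<alpha> v + real (unsplit \<xi> v)) * F (add_at (unsplit \<xi>) v))"
    unfolding msum_polya unsplit_add_at
    by (rule arg_cong[of _ _ "msum \<beta> k"], rule ext, rule sum_split_weights[OF \<beta>])
  also have "\<dots> = real (Suc k) * msum \<alpha> (Suc k) F"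
    unfolding msum_polya by (rule Suc.IH)
  finally show ?case by (simp del: of_nat_Suc)
qed

lemma sum_size_biased:
  fixes \<beta> :: "'a::finite \<Rightarrow> real"
  shows "(\<Sum>p\<in>UNIV. (\<beta> p + real (\<xi> p)) * ((\<beta> q + real (add_at \<xi> p q)) * g p))
    = (\<beta> q + real (\<xi> q)) * ((\<Sum>p\<in>UNIV. (\<beta> p + real (\<xi> p)) * g p) + g q)"
proof -
  have "(\<Sum>p\<in>UNIV. (\<beta> p + real (\<xi> p)) * ((\<beta> q + real (add_at \<xi> p q)) * g p))
     = (\<Sum>p\<in>UNIV. (\<beta> q + real (\<xi> q)) * ((\<beta> p + real (\<xi> p)) * g p) + (if p = q then (\<beta> q + real (\<xi> q)) * g q else 0))"
    by (intro sum.cong refl) (auto simp: algebra_simps add_at_def)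
  then show ?thesis by (simp add: sum.distrib sum_distrib_left distrib_left)
qed

text \<open>
  Given the occupation of a site, its slot holds on average the fraction \<open>t\<close> of the particles, which is also
  its fraction of the initial weight: a draw from the slot and a draw from the site are proportional on
  average, and so their proportion survives every further draw.
\<close>

lemma msum_unsplit_marked:
  fixes \<alpha> :: "'v::finite \<Rightarrow> real"
  assumes \<beta>: "splits \<beta> \<alpha>" and t: "\<beta> (x, True) = t * \<alpha> x"
  shows "msum \<beta> k (\<lambda>\<eta>. (\<beta> (x, True) + real (\<eta> (x, True))) * F (unsplit \<eta>))
     = t * msum \<alpha> k (\<lambda>\<eta>. (\<alpha> x + real (\<eta> x)) * F \<eta>)"
proof (induction k arbitrary: F)
  case 0
  show ?case by (simp add: msum_def configs_0 weight_def unsplit_def t)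
next
  case (Suc k)
  define H where "H \<zeta> = (\<Sum>z\<in>UNIV. (\<alpha> z + real (\<zeta> z)) * F (add_at \<zeta> z)) + F (add_at \<zeta> x)" for \<zeta>
  have "real (Suc k) * msum \<beta> (Suc k) (\<lambda>\<eta>. (\<beta> (x, True) + real (\<eta> (x, True))) * F (unsplit \<eta>))
      = msum \<beta> k (\<lambda>\<xi>. (\<beta> (x, True) + real (\<xi> (x, True))) * H (unsplit \<xi>))"
    unfolding msum_polya
  proof (rule msum_cong)
    fix \<xi> :: "'v \<times> bool \<Rightarrow> nat"
    show "(\<Sum>p\<in>UNIV. (\<beta> p + real (\<xi> p)) * ((\<beta> (x, True) + real (add_at \<xi> p (x, True))) * F (unsplit (add_at \<xi> p))))
        = (\<beta> (x, True) + real (\<xi> (x, True))) * H (unsplit \<xi>)"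
      unfolding sum_size_biased[of \<beta> \<xi> "(x, True)" "\<lambda>p. F (add_at (unsplit \<xi>) (fst p))"] H_def unsplit_add_at
        sum_split_weights[OF \<beta>, of \<xi> "\<lambda>v. F (add_at (unsplit \<xi>) v)"]
      by simp
  qed
  also have "\<dots> = t * msum \<alpha> k (\<lambda>\<zeta>. (\<alpha> x + real (\<zeta> x)) * H \<zeta>)" by (rule Suc.IH)
  also have "\<dots> = t * (real (Suc k) * msum \<alpha> (Suc k) (\<lambda>\<eta>. (\<alpha> x + real (\<eta> x)) * F \<eta>))"
  proof -
    have "(\<Sum>p\<in>UNIV. (\<alpha> p + real (\<xi> p)) * ((\<alpha> x + real (add_at \<xi> p x)) * F (add_at \<xi> p)))
       = (\<alpha> x + real (\<xi> x)) * H \<xi>" for \<xi>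
      unfolding H_def by (rule sum_size_biased)
    then show ?thesis unfolding msum_polya by simp
  qed
  finally have "real (Suc k) * msum \<beta> (Suc k) (\<lambda>\<eta>. (\<beta> (x, True) + real (\<eta> (x, True))) * F (unsplit \<eta>))
     = real (Suc k) * (t * msum \<alpha> (Suc k) (\<lambda>\<eta>. (\<alpha> x + real (\<eta> x)) * F \<eta>))"
    by (simp only: mult.left_commute)
  then show ?case by (simp del: of_nat_Suc)
qed

text \<open>
  Phrased with an added particle rather than with a jump, because in this form the property is visibly
  stable under the urn average.
\<close>

definition indifferent :: "(('a \<Rightarrow> nat) \<Rightarrow> real) \<Rightarrow> 'a \<Rightarrow> 'a \<Rightarrow> bool" where
  "indifferent h p q \<longleftrightarrow> (\<forall>\<xi>. h (add_at \<xi> p) = h (add_at \<xi> q))"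

text \<open>
  Adding a particle commutes with the draw, and it raises the total weight of the urn by one whether it is added
  at \<open>p\<close> or at \<open>q\<close>; the extra chance of drawing that very site is given to configurations which \<open>h\<close> cannot
  tell apart either.
\<close>

lemma indifferent_polya_mean:
  fixes \<beta> :: "'a::finite \<Rightarrow> real"
  assumes "indifferent h p q"
  shows "indifferent (polya_mean \<beta> h) p q"
  unfolding indifferent_def
proof
  fix \<xi>
  have h: "h (add_at \<xi> p) = h (add_at \<xi> q)" for \<xi> using assms by (simp add: indifferent_def)
  have num: "(\<Sum>z\<in>UNIV. (\<beta> z + real (add_at \<xi> r z)) * g z) = (\<Sum>z\<in>UNIV. (\<beta> z + real (\<xi> z)) * g z) + g r" for r g
  proof -
    have "(\<Sum>z\<in>UNIV. (\<beta> z + real (add_at \<xi> r z)) * g z)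
      = (\<Sum>z\<in>UNIV. (\<beta> z + real (\<xi> z)) * g z + (if z = r then g r else 0))"
      by (intro sum.cong refl) (auto simp: add_at_def algebra_simps)
    then show ?thesis by (simp add: sum.distrib)
  qed
  have "h (add_at (add_at \<xi> p) z) = h (add_at (add_at \<xi> q) z)" for z
    using h[of "add_at \<xi> z"] by (simp add: add_at_commute[of \<xi> _ z])
  moreover have "h (add_at (add_at \<xi> p) p) = h (add_at (add_at \<xi> q) q)"
    by (metis h add_at_commute)
  ultimately show "polya_mean \<beta> h (add_at \<xi> p) = polya_mean \<beta> h (add_at \<xi> q)"
    using num[of p "\<lambda>_. 1"] num[of q "\<lambda>_. 1"] by (simp add: polya_mean_def num)
qed

lemma polya_mean_diff:
  "polya_mean \<beta> (\<lambda>\<eta>. F \<eta> - G \<eta>) \<xi> = polya_mean \<beta> F \<xi> - polya_mean \<beta> G \<xi>"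
  by (simp add: polya_mean_def right_diff_distrib sum_subtractf diff_divide_distrib)

lemma polya_mean_unsplit:
  fixes \<alpha> :: "'v::finite \<Rightarrow> real"
  assumes "splits \<beta> \<alpha>"
  shows "polya_mean \<beta> (\<lambda>\<eta>. F (unsplit \<eta>)) \<xi> = polya_mean \<alpha> F (unsplit \<xi>)"
  unfolding polya_mean_def unsplit_add_at
  using sum_split_weights[OF assms, of \<xi> "\<lambda>_. 1"] sum_split_weights[OF assms, of \<xi> "\<lambda>v. F (add_at (unsplit \<xi>) v)"]
  by simp

lemma polya_mean_const:
  assumes "(\<Sum>x\<in>UNIV. \<beta> x + real (\<xi> x)) \<noteq> 0"
  shows "polya_mean \<beta> (\<lambda>_. c) \<xi> = c"
  using assms by (simp add: polya_mean_def flip: sum_distrib_right)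

text \<open>
  This is the step from pairs of sites to all sites, by the decomposition of second moments along the last
  draw. The averaged functions satisfy the same hypotheses with one particle less. In the fluctuation of the
  last draw, \<open>h x y\<close> cancels in all differences between the slot of \<open>x\<close> and the parts of \<open>y\<close>, so what remains is
  the fluctuation of \<open>f\<close> itself; the slot contributes at least the fraction \<open>r\<close> of the weight of its site,
  and summing over \<open>x\<close> and \<open>y\<close> yields \<open>r\<close> times the full fluctuation of \<open>f\<close>. No factor depends on the
  number of particles. Only \<open>x\<close> is
  restricted to its slot: using slots at both ends would cost \<open>r\<^sup>2\<close>.
\<close>

lemma variance_le_sum_dist_indifferent:
  fixes \<alpha> :: "'v::finite \<Rightarrow> real"
  assumes \<alpha>: "\<And>x. \<alpha> x > 0" and \<beta>: "splits \<beta> \<alpha>" "\<And>p. \<beta> p \<ge> 0"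
    and r: "\<And>x. r * \<alpha> x \<le> \<beta> (x, True)" "r \<ge> 0"
    and h: "\<And>x y. x \<noteq> y \<Longrightarrow> indifferent (h x y) (x, True) (y, True)"
      "\<And>x y. x \<noteq> y \<Longrightarrow> indifferent (h x y) (x, True) (y, False)"
  shows "\<exists>c. r * msum \<alpha> k (\<lambda>\<eta>. (f \<eta> - c)\<^sup>2)
    \<le> (\<Sum>x\<in>UNIV. \<Sum>y\<in>UNIV-{x}. msum \<beta> k (\<lambda>\<eta>. (f (unsplit \<eta>) - h x y \<eta>)\<^sup>2))"
  using h
proof (induction k arbitrary: f h)
  case 0
  have "0 \<le> (\<Sum>x\<in>UNIV. \<Sum>y\<in>UNIV-{x}. msum \<beta> 0 (\<lambda>\<eta>. (f (unsplit \<eta>) - h x y \<eta>)\<^sup>2))"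
    by (intro sum_nonneg msum_nonneg \<beta>) auto
  then show ?case by (intro exI[of _ "f (\<lambda>_. 0)"]) (simp add: msum_def configs_0)
next
  case (Suc k)
  define S where "S = sum \<alpha> UNIV + real k"
  have \<alpha>0: "\<And>x. \<alpha> x \<ge> 0" using \<alpha> by (simp add: less_imp_le)
  have S\<beta>: "S = sum \<beta> UNIV + real k"
    using \<beta>(1) by (simp add: S_def sum_pairs splits_def)
  have S: "S > 0"
    using \<alpha> by (auto simp: S_def intro!: add_pos_nonneg sum_pos)
  define e where "e x y \<xi> = (f (add_at \<xi> x) - f (add_at \<xi> y))\<^sup>2" for x y \<xi>
  obtain c where c: "r * msum \<alpha> k (\<lambda>\<eta>. (polya_mean \<alpha> f \<eta> - c)\<^sup>2)
    \<le> (\<Sum>x\<in>UNIV. \<Sum>y\<in>UNIV-{x}. msum \<beta> k (\<lambda>\<eta>. (polya_mean \<alpha> f (unsplit \<eta>) - polya_mean \<beta> (h x y) \<eta>)\<^sup>2))"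
    using Suc.IH[of "\<lambda>x y. polya_mean \<beta> (h x y)" "polya_mean \<alpha> f"] Suc.prems indifferent_polya_mean by metis
  have bound: "real (Suc k) * msum \<beta> (Suc k) (\<lambda>\<eta>. (f (unsplit \<eta>) - h x y \<eta>)\<^sup>2)
     \<ge> S * msum \<beta> k (\<lambda>\<eta>. (polya_mean \<alpha> f (unsplit \<eta>) - polya_mean \<beta> (h x y) \<eta>)\<^sup>2)
       + r * msum \<alpha> k (\<lambda>\<xi>. (\<alpha> x + real (\<xi> x)) * (\<alpha> y + real (\<xi> y)) * e x y \<xi>) / (2 * S)"
    if xy: "x \<noteq> y" for x y
  proof -
    define b where "b \<xi> p = \<beta> p + real (\<xi> p)" for \<xi> p
    have b: "b \<xi> p \<ge> 0" for \<xi> p using \<beta>(2)[of p] by (simp add: b_def)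
    define G where "G \<eta> = f (unsplit \<eta>) - h x y \<eta>" for \<eta>
    have G: "(G (add_at \<xi> (x, True)) - G (add_at \<xi> (y, j)))\<^sup>2 = e x y (unsplit \<xi>)" for \<xi> j
    proof -
      have "h x y (add_at \<xi> (x, True)) = h x y (add_at \<xi> (y, j))"
        using Suc.prems[OF xy] by (cases j) (auto simp: indifferent_def)
      then show ?thesis by (simp add: G_def e_def unsplit_add_at)
    qed
    \<comment> \<open>Of all pairs in the lifted system only those joining the slot of \<open>x\<close> to one of the two parts of \<open>y\<close>
      are kept; averaging over the splitting turns them back into the pair \<open>(x, y)\<close>.\<close>
    define t where "t = \<beta> (x, True) / \<alpha> x"
    have t: "\<beta> (x, True) = t * \<alpha> x" "r \<le> t"
      using \<alpha>[of x] r(1)[of x] by (auto simp: t_def pos_le_divide_eq)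
    have "r * msum \<alpha> k (\<lambda>\<xi>. (\<alpha> x + real (\<xi> x)) * ((\<alpha> y + real (\<xi> y)) * e x y \<xi>))
       \<le> t * msum \<alpha> k (\<lambda>\<xi>. (\<alpha> x + real (\<xi> x)) * ((\<alpha> y + real (\<xi> y)) * e x y \<xi>))"
      using t(2) \<alpha>0 by (intro mult_right_mono msum_nonneg mult_nonneg_nonneg add_nonneg_nonneg) (auto simp: e_def)
    also have "\<dots> = msum \<beta> k (\<lambda>\<xi>. b \<xi> (x, True) * ((\<alpha> y + real (unsplit \<xi> y)) * e x y (unsplit \<xi>)))"
      unfolding b_def by (rule msum_unsplit_marked[OF \<beta>(1) t(1), symmetric])
    also have "\<dots> \<le> msum \<beta> k (\<lambda>\<xi>. \<Sum>p\<in>UNIV. \<Sum>q\<in>UNIV. b \<xi> p * b \<xi> q * (G (add_at \<xi> p) - G (add_at \<xi> q))\<^sup>2)"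
    proof (rule msum_mono[OF \<beta>(2)])
      fix \<xi> :: "'v \<times> bool \<Rightarrow> nat"
      let ?t = "\<lambda>p q. b \<xi> p * b \<xi> q * (G (add_at \<xi> p) - G (add_at \<xi> q))\<^sup>2"
      have t0: "?t p q \<ge> 0" for p q by (intro mult_nonneg_nonneg b) auto
      have "b \<xi> (x, True) * ((\<alpha> y + real (unsplit \<xi> y)) * e x y (unsplit \<xi>))
          = b \<xi> (x, True) * ((b \<xi> (y, True) + b \<xi> (y, False)) * e x y (unsplit \<xi>))"
        using \<beta>(1) by (simp add: b_def splits_def unsplit_def)
      also have "\<dots> = sum (?t (x, True)) {(y, True), (y, False)}"
        by (simp add: G algebra_simps)
      also have "\<dots> \<le> sum (?t (x, True)) UNIV"
        by (rule sum_mono2) (auto intro: t0)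
      also have "\<dots> \<le> (\<Sum>p\<in>UNIV. sum (?t p) UNIV)"
        by (rule member_le_sum) (auto intro: sum_nonneg t0)
      finally show "b \<xi> (x, True) * ((\<alpha> y + real (unsplit \<xi> y)) * e x y (unsplit \<xi>)) \<le> (\<Sum>p\<in>UNIV. sum (?t p) UNIV)" .
    qed
    finally have "r * msum \<alpha> k (\<lambda>\<xi>. (\<alpha> x + real (\<xi> x)) * (\<alpha> y + real (\<xi> y)) * e x y \<xi>) / (2 * S)
       \<le> msum \<beta> k (\<lambda>\<xi>. \<Sum>p\<in>UNIV. \<Sum>q\<in>UNIV. b \<xi> p * b \<xi> q * (G (add_at \<xi> p) - G (add_at \<xi> q))\<^sup>2) / (2 * S)"
      using S by (simp add: divide_right_mono mult.assoc)
    moreover have "polya_mean \<beta> G \<xi> = polya_mean \<alpha> f (unsplit \<xi>) - polya_mean \<beta> (h x y) \<xi>" for \<xi>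
      unfolding G_def polya_mean_diff polya_mean_unsplit[OF \<beta>(1)] ..
    ultimately show ?thesis
      unfolding G_def[symmetric] msum_square_decomposition[OF S\<beta> S, of G] b_def by simp
  qed
  let ?E = "\<lambda>x y. msum \<alpha> k (\<lambda>\<xi>. (\<alpha> x + real (\<xi> x)) * (\<alpha> y + real (\<xi> y)) * e x y \<xi>)"
  have diag: "sum (?E x) UNIV = sum (?E x) (UNIV - {x})" for x
    by (subst sum.remove[of UNIV x]) (auto simp: e_def msum_def)
  have mean: "polya_mean \<alpha> (\<lambda>\<eta>. f \<eta> - c) \<xi> = polya_mean \<alpha> f \<xi> - c" if "\<xi> \<in> configs k" for \<xi>
    unfolding polya_mean_diff using polya_mean_const[of \<alpha> \<xi> c] sum_weights_configs[OF that, of \<alpha>] S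
    by (simp add: S_def)
  have "real (Suc k) * msum \<alpha> (Suc k) (\<lambda>\<eta>. (f \<eta> - c)\<^sup>2)
     = S * msum \<alpha> k (\<lambda>\<eta>. (polya_mean \<alpha> f \<eta> - c)\<^sup>2) + (\<Sum>x\<in>UNIV. sum (?E x) (UNIV - {x})) / (2 * S)"
    unfolding msum_square_decomposition[OF S_def S] diag[symmetric]
    by (simp add: msum_sum e_def mean cong: msum_cong)
  then have "real (Suc k) * (r * msum \<alpha> (Suc k) (\<lambda>\<eta>. (f \<eta> - c)\<^sup>2))
     = S * (r * msum \<alpha> k (\<lambda>\<eta>. (polya_mean \<alpha> f \<eta> - c)\<^sup>2)) + (\<Sum>x\<in>UNIV. \<Sum>y\<in>UNIV-{x}. r * ?E x y / (2 * S))"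
    by (simp add: distrib_left mult.left_commute sum_distrib_left sum_divide_distrib)
  also have "\<dots> \<le> S * (\<Sum>x\<in>UNIV. \<Sum>y\<in>UNIV-{x}. msum \<beta> k (\<lambda>\<eta>. (polya_mean \<alpha> f (unsplit \<eta>) - polya_mean \<beta> (h x y) \<eta>)\<^sup>2))
      + (\<Sum>x\<in>UNIV. \<Sum>y\<in>UNIV-{x}. r * ?E x y / (2 * S))"
    using c S by simp
  also have "\<dots> = (\<Sum>x\<in>UNIV. \<Sum>y\<in>UNIV-{x}.
      S * msum \<beta> k (\<lambda>\<eta>. (polya_mean \<alpha> f (unsplit \<eta>) - polya_mean \<beta> (h x y) \<eta>)\<^sup>2) + r * ?E x y / (2 * S))"
    by (simp only: sum_distrib_left sum.distrib)
  also have "\<dots> \<le> (\<Sum>x\<in>UNIV. \<Sum>y\<in>UNIV-{x}. real (Suc k) * msum \<beta> (Suc k) (\<lambda>\<eta>. (f (unsplit \<eta>) - h x y \<eta>)\<^sup>2))"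
    by (intro sum_mono bound) auto
  also have "\<dots> = real (Suc k) * (\<Sum>x\<in>UNIV. \<Sum>y\<in>UNIV-{x}. msum \<beta> (Suc k) (\<lambda>\<eta>. (f (unsplit \<eta>) - h x y \<eta>)\<^sup>2))"
    by (simp only: sum_distrib_left)
  finally show ?case
    by (intro exI[of _ c]) (simp only: mult_le_cancel_left_pos of_nat_0_less_iff zero_less_Suc)
qed

section \<open>Transport along a path\<close>

definition l2norm :: "('a::finite \<Rightarrow> real) \<Rightarrow> nat \<Rightarrow> (('a \<Rightarrow> nat) \<Rightarrow> real) \<Rightarrow> real" where
  "l2norm \<beta> k F = sqrt (msum \<beta> k (\<lambda>\<eta>. (F \<eta>)\<^sup>2))"

lemma l2norm_eq_L2_set:
  assumes "\<And>x. \<beta> x \<ge> 0"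
  shows "l2norm \<beta> k F = L2_set (\<lambda>\<eta>. sqrt (weight \<beta> \<eta>) * F \<eta>) (configs k)"
proof -
  have "weight \<beta> \<eta> \<ge> 0" for \<eta> by (rule weight_nonneg) (rule assms)
  then show ?thesis by (simp add: l2norm_def L2_set_def msum_def power_mult_distrib)
qed

lemma l2norm_triangle:
  assumes "\<And>x. \<beta> x \<ge> 0"
  shows "l2norm \<beta> k (\<lambda>\<eta>. F \<eta> - H \<eta>) \<le> l2norm \<beta> k (\<lambda>\<eta>. F \<eta> - G \<eta>) + l2norm \<beta> k (\<lambda>\<eta>. G \<eta> - H \<eta>)"
  unfolding l2norm_eq_L2_set[OF assms]
  using L2_set_triangle_ineq[of "\<lambda>\<eta>. sqrt (weight \<beta> \<eta>) * (F \<eta> - G \<eta>)" "\<lambda>\<eta>. sqrt (weight \<beta> \<eta>) * (G \<eta> - H \<eta>)"]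
  by (simp add: algebra_simps)

lemma msum_permute:
  fixes \<beta> :: "'a::finite \<Rightarrow> real"
  assumes "\<And>x. \<pi> (\<pi> x) = x" "\<And>x. \<beta> (\<pi> x) = \<beta> x"
  shows "msum \<beta> k (\<lambda>\<eta>. F (\<eta> \<circ> \<pi>)) = msum \<beta> k F"
proof -
  have bij: "bij_betw \<pi> UNIV UNIV" using assms(1) by (metis bij_betw_byWitness subset_UNIV)
  have conf: "\<eta> \<circ> \<pi> \<in> configs k" if "\<eta> \<in> configs k" for \<eta>
    using that sum.reindex_bij_betw[OF bij, of \<eta>] by (simp add: configs_def)
  have w: "weight \<beta> (\<eta> \<circ> \<pi>) = weight \<beta> \<eta>" for \<eta>
    using prod.reindex_bij_betw[OF bij, of "\<lambda>x. polya_weight (\<beta> x) (\<eta> x)"] by (simp add: weight_def assms(2))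
  show ?thesis
    unfolding msum_def
    by (rule sum.reindex_bij_witness[of _ "\<lambda>\<eta>. \<eta> \<circ> \<pi>" "\<lambda>\<eta>. \<eta> \<circ> \<pi>"]) (auto simp: conf w comp_assoc fun_eq_iff assms(1))
qed

lemma gather_add_at: "gather u v (add_at \<zeta> u) = gather u v (add_at \<zeta> v)"
  by (auto simp: gather_def add_at_def fun_eq_iff)

lemma gather_unsplit_swap:
  "u \<noteq> v \<Longrightarrow> gather u v (unsplit (\<eta> \<circ> Transposition.transpose (u, True) (v, True))) = gather u v (unsplit \<eta>)"
  by (auto simp: gather_def unsplit_def Transposition.transpose_def fun_eq_iff)

lemma add_at_permute:
  assumes "\<And>x. \<pi> (\<pi> x) = x"
  shows "add_at \<xi> p \<circ> \<pi> = add_at (\<xi> \<circ> \<pi>) (\<pi> p)"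
  using assms by (auto simp: add_at_def fun_eq_iff)

text \<open>
  Transport along a path \<open>p 0, \<dots>, p n\<close>. For the last step, the function of \<open>gather\<close> close to \<open>f\<close> is
  itself indifferent. To move the starting point back along an edge, swap the slots at the two ends of that
  edge: the swap preserves the measure because slots have equal weight, and it carries an indifferent
  function to an indifferent one. The swap moves \<open>f\<close> by at most twice the distance of \<open>f\<close> to the functions
  that cannot see this edge, since these are fixed by the swap. The costs therefore add up along the path
  instead of being multiplied.
\<close>

lemma dist_indifferent_le_path:
  fixes \<alpha> :: "'v::finite \<Rightarrow> real" and g :: "'v \<Rightarrow> 'v \<Rightarrow> ('v \<Rightarrow> nat) \<Rightarrow> real"
  assumes \<beta>: "splits \<beta> \<alpha>" "\<And>p. \<beta> p \<ge> 0" "\<And>v. \<beta> (v, True) = t"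
    and p: "inj_on p {..n}" "n > 0"
  shows "\<exists>h. indifferent h (p 0, True) (p n, True) \<and> indifferent h (p 0, True) (p n, False) \<and>
    l2norm \<beta> k (\<lambda>\<eta>. f (unsplit \<eta>) - h \<eta>)
     \<le> 2 * (\<Sum>j<n. l2norm \<alpha> k (\<lambda>\<eta>. f \<eta> - g (p j) (p (Suc j)) (gather (p j) (p (Suc j)) \<eta>)))"
proof -
  let ?q = "\<lambda>j. l2norm \<alpha> k (\<lambda>\<eta>. f \<eta> - g (p j) (p (Suc j)) (gather (p j) (p (Suc j)) \<eta>))"
  define G where "G j \<eta> = g (p j) (p (Suc j)) (gather (p j) (p (Suc j)) (unsplit \<eta>))" for j and \<eta> :: "'v \<times> bool \<Rightarrow> nat"
  have \<alpha>: "\<alpha> x \<ge> 0" for x using \<beta>(1) \<beta>(2)[of "(x, _)"] unfolding splits_def by (metis add_nonneg_nonneg)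
  have q: "l2norm \<beta> k (\<lambda>\<eta>. f (unsplit \<eta>) - G j \<eta>) = ?q j" for j
    unfolding l2norm_def G_def by (simp only: msum_unsplit[OF \<beta>(1), of k "\<lambda>\<eta>. (f \<eta> - g (p j) (p (Suc j)) (gather (p j) (p (Suc j)) \<eta>))\<^sup>2"])
  have q0: "?q j \<ge> 0" for j by (simp add: l2norm_def msum_nonneg \<alpha>)
  define m where "m = n - 1"
  have n: "n = Suc m" using p(2) by (simp add: m_def)
  have "\<exists>h. indifferent h (p i, True) (p n, True) \<and> indifferent h (p i, True) (p n, False) \<and>
    l2norm \<beta> k (\<lambda>\<eta>. f (unsplit \<eta>) - h \<eta>) \<le> 2 * (\<Sum>j\<in>{i..<n}. ?q j)" if "i \<le> m" for i
    using that
  proof (induction rule: inc_induct)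
    case base
    have "indifferent (G m) (p m, True) (p n, b)" for b
      unfolding indifferent_def G_def n unsplit_add_at fst_conv
      using gather_add_at[of "p m" "p (Suc m)"] by simp
    moreover have "l2norm \<beta> k (\<lambda>\<eta>. f (unsplit \<eta>) - G m \<eta>) \<le> 2 * (\<Sum>j\<in>{m..<n}. ?q j)"
      unfolding q n using q0[of m] by simp
    ultimately show ?case by blast
  next
    case (step i)
    then obtain h where h: "indifferent h (p (Suc i), True) (p n, True)" "indifferent h (p (Suc i), True) (p n, False)"
      "l2norm \<beta> k (\<lambda>\<eta>. f (unsplit \<eta>) - h \<eta>) \<le> 2 * (\<Sum>j\<in>{Suc i..<n}. ?q j)" by blast
    \<comment> \<open>The end \<open>p n\<close> is not touched by the swap because the path does not return to a site.\<close>
    define \<pi> where "\<pi> = Transposition.transpose (p i, True) (p (Suc i), True)"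
    have \<pi>: "\<pi> (\<pi> z) = z" "\<beta> (\<pi> z) = \<beta> z" for z
      using \<beta>(3) by (auto simp: \<pi>_def Transposition.transpose_def)
    have ne: "p i \<noteq> p (Suc i)" "p n \<noteq> p i" "p n \<noteq> p (Suc i)"
      using inj_onD[OF p(1)] step.hyps n by (metis atMost_iff less_or_eq_imp_le n_not_Suc_n nat_less_le Suc_leI less_Suc_eq)+
    have \<pi>n: "\<pi> (p n, b) = (p n, b)" "\<pi> (p i, True) = (p (Suc i), True)" for b
      using ne by (auto simp: \<pi>_def Transposition.transpose_def)
    have norm\<pi>: "l2norm \<beta> k (\<lambda>\<eta>. F (\<eta> \<circ> \<pi>)) = l2norm \<beta> k F" for F
      unfolding l2norm_def using msum_permute[of \<pi> \<beta> k "\<lambda>\<eta>. (F \<eta>)\<^sup>2"] \<pi> by simp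
    have G\<pi>: "G i (\<eta> \<circ> \<pi>) = G i \<eta>" for \<eta>
      unfolding G_def \<pi>_def gather_unsplit_swap[OF ne(1)] ..
    let ?h = "\<lambda>\<eta>. h (\<eta> \<circ> \<pi>)"
    have "indifferent ?h (p i, True) (p n, b)" for b
      using h(1,2) unfolding indifferent_def add_at_permute[OF \<pi>(1)] \<pi>n by (cases b) auto
    moreover have "l2norm \<beta> k (\<lambda>\<eta>. f (unsplit \<eta>) - ?h \<eta>) \<le> 2 * (\<Sum>j\<in>{i..<n}. ?q j)"
    proof -
      have "l2norm \<beta> k (\<lambda>\<eta>. f (unsplit \<eta>) - ?h \<eta>)
         \<le> l2norm \<beta> k (\<lambda>\<eta>. f (unsplit \<eta>) - G i \<eta>) + l2norm \<beta> k (\<lambda>\<eta>. G i \<eta> - ?h \<eta>)"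
        by (rule l2norm_triangle[OF \<beta>(2)])
      also have "l2norm \<beta> k (\<lambda>\<eta>. G i \<eta> - ?h \<eta>)
         \<le> l2norm \<beta> k (\<lambda>\<eta>. G i \<eta> - f (unsplit (\<eta> \<circ> \<pi>))) + l2norm \<beta> k (\<lambda>\<eta>. f (unsplit (\<eta> \<circ> \<pi>)) - ?h \<eta>)"
        by (rule l2norm_triangle[OF \<beta>(2)])
      also have "l2norm \<beta> k (\<lambda>\<eta>. f (unsplit (\<eta> \<circ> \<pi>)) - ?h \<eta>) = l2norm \<beta> k (\<lambda>\<eta>. f (unsplit \<eta>) - h \<eta>)"
        by (rule norm\<pi>)
      also have "l2norm \<beta> k (\<lambda>\<eta>. G i \<eta> - f (unsplit (\<eta> \<circ> \<pi>))) = l2norm \<beta> k (\<lambda>\<eta>. f (unsplit \<eta>) - G i \<eta>)"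
        using norm\<pi>[of "\<lambda>\<eta>. G i \<eta> - f (unsplit \<eta>)"] by (simp add: G\<pi> l2norm_def power2_commute)
      finally have "l2norm \<beta> k (\<lambda>\<eta>. f (unsplit \<eta>) - ?h \<eta>) \<le> 2 * ?q i + 2 * (\<Sum>j\<in>{Suc i..<n}. ?q j)"
        using h(3) unfolding q by (simp add: comp_def)
      also have "\<dots> = 2 * (\<Sum>j\<in>{i..<n}. ?q j)"
        using step.hyps n by (simp add: sum.atLeast_Suc_lessThan)
      finally show ?thesis by simp
    qed
    ultimately show ?case by blast
  qed
  from this[of 0] show ?thesis by (simp add: lessThan_atLeast0)
qed

section \<open>The Poincare inequality on a graph\<close>

lemma graph_distance_le_diam:
  fixes c :: "'v::finite \<Rightarrow> 'v \<Rightarrow> real"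
  assumes "x \<noteq> y"
  shows "graph_distance c x y \<le> graph_diam c"
proof -
  have "{graph_distance c x y | x y. x \<noteq> y} \<subseteq> (\<lambda>(x, y). graph_distance c x y) ` UNIV" by auto
  then have "finite {graph_distance c x y | x y. x \<noteq> y}" by (rule finite_subset) simp
  then show ?thesis unfolding graph_diam_def using assms by (intro Max_ge) auto
qed

lemma relpow_segment:
  assumes "\<And>i. i < n \<Longrightarrow> (p i, p (Suc i)) \<in> R" "i \<le> j" "j \<le> n"
  shows "(p i, p j) \<in> R ^^ (j - i)"
  unfolding relpow_fun_conv using assms by (intro exI[of _ "\<lambda>l. p (i + l)"]) auto

text \<open>
  A shortest path visits no site twice, as otherwise the loop could be cut out. Its edges are then distinct,
  so the costs along it sum to at most the total over all edges.
\<close>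

lemma geodesic:
  fixes c :: "'v::finite \<Rightarrow> 'v \<Rightarrow> real"
  assumes "(x, y) \<in> (cond_edges c)\<^sup>*"
  obtains p where "p 0 = x" "p (graph_distance c x y) = y" "inj_on p {..graph_distance c x y}"
    "\<And>i. i < graph_distance c x y \<Longrightarrow> (p i, p (Suc i)) \<in> cond_edges c"
proof -
  let ?n = "graph_distance c x y"
  have "(x, y) \<in> cond_edges c ^^ ?n"
    unfolding graph_distance_def using rtrancl_imp_relpow[OF assms] by (rule LeastI_ex)
  then obtain p where p: "p 0 = x" "p ?n = y" "\<And>i. i < ?n \<Longrightarrow> (p i, p (Suc i)) \<in> cond_edges c"
    unfolding relpow_fun_conv by blast
  have segment: "(p i, p j) \<in> cond_edges c ^^ (j - i)" if "i \<le> j" "j \<le> ?n" for i j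
    using p(3) that by (rule relpow_segment)
  have "p i \<noteq> p j" if "i < j" "j \<le> ?n" for i j
  proof
    assume eq: "p i = p j"
    have "(p 0, p i) \<in> cond_edges c ^^ i" "(p j, p ?n) \<in> cond_edges c ^^ (?n - j)"
      using segment[of 0 i] segment[of j ?n] that by auto
    then have "(x, y) \<in> cond_edges c ^^ (i + (?n - j))"
      unfolding relpow_add using p(1,2) eq by (auto simp: relcomp.simps)
    then have "?n \<le> i + (?n - j)"
      unfolding graph_distance_def by (rule Least_le)
    then show False using that by linarith
  qed
  then have "inj_on p {..?n}" by (auto intro!: inj_onI) (metis linorder_neqE_nat)
  with p that show thesis by blast
qed

definition dirichlet_form ::
  "('v::finite \<Rightarrow> 'v \<Rightarrow> real) \<Rightarrow> ('v \<Rightarrow> real) \<Rightarrow> nat \<Rightarrow> (('v \<Rightarrow> nat) \<Rightarrow> real) \<Rightarrow> real" where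
  "dirichlet_form c \<alpha> k f = (\<Sum>x\<in>UNIV. \<Sum>y\<in>UNIV. c x y * pair_energy \<alpha> k f x y) / 2"

lemma pair_energy_nonneg:
  assumes "\<And>x. \<alpha> x > 0"
  shows "pair_energy \<alpha> k f x y \<ge> 0"
  unfolding pair_energy_def using assms by (intro msum_nonneg) (auto simp: less_imp_le add_pos_nonneg)

lemma c_min_le:
  fixes c :: "'v::finite \<Rightarrow> 'v \<Rightarrow> real"
  assumes "c x y > 0" shows "c_min c \<le> c x y"
proof -
  have "{c x y | x y. c x y > 0} \<subseteq> (\<lambda>(x, y). c x y) ` UNIV" by auto
  then have "finite {c x y | x y. c x y > 0}" by (rule finite_subset) simp
  then show ?thesis unfolding c_min_def using assms by (intro Min_le) auto
qed

lemma c_min_edge_energy_le: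
  fixes c :: "'v::finite \<Rightarrow> 'v \<Rightarrow> real"
  assumes c: "\<And>x y. c x y \<ge> 0" and \<alpha>: "\<And>x. \<alpha> x > 0"
  shows "c_min c * (\<Sum>(x, y)\<in>cond_edges c. pair_energy \<alpha> k f x y) \<le> 2 * dirichlet_form c \<alpha> k f"
proof -
  have "c_min c * (\<Sum>(x, y)\<in>cond_edges c. pair_energy \<alpha> k f x y)
      \<le> (\<Sum>(x, y)\<in>cond_edges c. c x y * pair_energy \<alpha> k f x y)"
    unfolding sum_distrib_left
    by (intro sum_mono) (auto simp: cond_edges_def intro!: mult_right_mono c_min_le pair_energy_nonneg \<alpha>)
  also have "\<dots> \<le> (\<Sum>(x, y)\<in>UNIV. c x y * pair_energy \<alpha> k f x y)"
    using c by (intro sum_mono2) (auto intro!: mult_nonneg_nonneg pair_energy_nonneg \<alpha>)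
  also have "\<dots> = 2 * dirichlet_form c \<alpha> k f"
    by (simp add: dirichlet_form_def sum.cartesian_product)
  finally show ?thesis .
qed

text \<open>
  An edge comes with the constant \<open>\<alpha> u + \<alpha> v \<ge> 2 * alpha_min \<alpha>\<close>; transport along geodesics with the
  Cauchy-Schwarz inequality gives the diameter; there are at most \<open>CARD('v)\<^sup>2\<close> pairs of sites; and slots of weight
  \<open>alpha_min \<alpha>\<close> make up at least the fraction \<open>alpha_ratio \<alpha>\<close> of every site.
\<close>

theorem sip_poincare:
  fixes c :: "'v::finite \<Rightarrow> 'v \<Rightarrow> real"
  assumes c: "connected_weighted_graph c" and \<alpha>: "\<And>x. \<alpha> x > 0" and cpos: "c_min c > 0"
  shows "\<exists>m. alpha_min \<alpha> * alpha_ratio \<alpha> * c_min c * msum \<alpha> k (\<lambda>\<eta>. (f \<eta> - m)\<^sup>2)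
    \<le> 4 * (real CARD('v))\<^sup>2 * real (graph_diam c) * dirichlet_form c \<alpha> k f"
proof -
  define a where "a = alpha_min \<alpha>"
  define D where "D = dirichlet_form c \<alpha> k f"
  let ?d = "real (graph_diam c)"
  have a: "a \<le> \<alpha> x" for x by (simp add: a_def alpha_min_def)
  have a0: "a > 0" using \<alpha> by (simp add: a_def alpha_min_def)
  have c0: "\<And>x y. c x y \<ge> 0" and cdiag: "\<And>x. c x x = 0" and conn: "\<And>x y. (x, y) \<in> (cond_edges c)\<^sup>*"
    using c by (auto simp: connected_weighted_graph_def)
  define \<beta> where "\<beta> = (\<lambda>(v, b). if b then a else \<alpha> v - a)"
  have \<beta>: "splits \<beta> \<alpha>" "\<And>p. \<beta> p \<ge> 0" "\<And>v. \<beta> (v, True) = a"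
    using a a0 by (auto simp: \<beta>_def splits_def split: prod.splits)
  have "\<exists>g. (\<alpha> u + \<alpha> v) * msum \<alpha> k (\<lambda>\<eta>. (f \<eta> - g (gather u v \<eta>))\<^sup>2) \<le> pair_energy \<alpha> k f u v"
    if "u \<noteq> v" for u v
    using pair_poincare[OF that] \<alpha> by blast
  then obtain g where g: "\<And>u v. u \<noteq> v \<Longrightarrow>
      (\<alpha> u + \<alpha> v) * msum \<alpha> k (\<lambda>\<eta>. (f \<eta> - g u v (gather u v \<eta>))\<^sup>2) \<le> pair_energy \<alpha> k f u v"
    by metis
  define q where "q u v = msum \<alpha> k (\<lambda>\<eta>. (f \<eta> - g u v (gather u v \<eta>))\<^sup>2)" for u v
  have q0: "q u v \<ge> 0" for u v using \<alpha> by (auto simp: q_def less_imp_le intro!: msum_nonneg)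
  have q: "2 * a * q u v \<le> pair_energy \<alpha> k f u v" if "(u, v) \<in> cond_edges c" for u v
  proof -
    have "2 * a * q u v \<le> (\<alpha> u + \<alpha> v) * q u v" using a[of u] a[of v] q0 by (intro mult_right_mono) auto
    also have "\<dots> \<le> pair_energy \<alpha> k f u v"
      unfolding q_def using that cdiag by (intro g) (auto simp: cond_edges_def)
    finally show ?thesis .
  qed
  define P where "P x y h \<longleftrightarrow> indifferent h (x, True) (y, True) \<and> indifferent h (x, True) (y, False) \<and>
      a * c_min c * msum \<beta> k (\<lambda>\<eta>. (f (unsplit \<eta>) - h \<eta>)\<^sup>2) \<le> 4 * ?d * D" for x y h
  have ex: "\<exists>h. P x y h" if xy: "x \<noteq> y" for x y
  proof -
    define n where "n = graph_distance c x y"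
    obtain p where p: "p 0 = x" "p n = y" "inj_on p {..n}" "\<And>i. i < n \<Longrightarrow> (p i, p (Suc i)) \<in> cond_edges c"
      using geodesic[OF conn, of x y] unfolding n_def by metis
    have n: "n > 0" using p(1,2) xy by (cases n) auto
    obtain h where h: "indifferent h (x, True) (y, True)" "indifferent h (x, True) (y, False)"
      "l2norm \<beta> k (\<lambda>\<eta>. f (unsplit \<eta>) - h \<eta>) \<le> 2 * (\<Sum>j<n. sqrt (q (p j) (p (Suc j))))"
      using dist_indifferent_le_path[OF \<beta> p(3) n, of k f g] unfolding p(1,2) l2norm_def q_def by blast
    have "msum \<beta> k (\<lambda>\<eta>. (f (unsplit \<eta>) - h \<eta>)\<^sup>2) = (l2norm \<beta> k (\<lambda>\<eta>. f (unsplit \<eta>) - h \<eta>))\<^sup>2"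
      unfolding l2norm_def by (subst real_sqrt_pow2) (auto intro!: msum_nonneg \<beta>)
    also have "\<dots> \<le> (2 * (\<Sum>j<n. sqrt (q (p j) (p (Suc j)))))\<^sup>2"
      using h(3) by (rule power_mono) (auto simp: l2norm_def intro!: msum_nonneg \<beta>)
    also have "\<dots> \<le> 4 * (real n * (\<Sum>j<n. (sqrt (q (p j) (p (Suc j))))\<^sup>2))"
      using sum_squared_le_sum_of_squares[of "\<lambda>j. sqrt (q (p j) (p (Suc j)))" "{..<n}"]
      by (simp add: power_mult_distrib mult.commute)
    also have "(\<Sum>j<n. (sqrt (q (p j) (p (Suc j))))\<^sup>2) = (\<Sum>(u, v)\<in>(\<lambda>j. (p j, p (Suc j))) ` {..<n}. q u v)"
    proof (subst sum.reindex)
      show "inj_on (\<lambda>j. (p j, p (Suc j))) {..<n}"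
        using p(3) by (auto simp: inj_on_def)
    qed (simp add: q0)
    also have "4 * (real n * (\<Sum>(u, v)\<in>(\<lambda>j. (p j, p (Suc j))) ` {..<n}. q u v))
       \<le> 4 * (?d * (\<Sum>(u, v)\<in>cond_edges c. q u v))"
    proof (intro mult_left_mono mult_mono)
      show "real n \<le> ?d" using graph_distance_le_diam[OF xy] by (simp add: n_def)
      show "(\<Sum>(u, v)\<in>(\<lambda>j. (p j, p (Suc j))) ` {..<n}. q u v) \<le> (\<Sum>(u, v)\<in>cond_edges c. q u v)"
        using p(4) by (intro sum_mono2) (auto simp: q0)
    qed (auto intro!: sum_nonneg simp: q0)
    finally have "msum \<beta> k (\<lambda>\<eta>. (f (unsplit \<eta>) - h \<eta>)\<^sup>2) \<le> 4 * (?d * (\<Sum>(u, v)\<in>cond_edges c. q u v))" .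
    then have "a * c_min c * msum \<beta> k (\<lambda>\<eta>. (f (unsplit \<eta>) - h \<eta>)\<^sup>2)
       \<le> a * c_min c * (4 * (?d * (\<Sum>(u, v)\<in>cond_edges c. q u v)))"
      using a0 cpos by (intro mult_left_mono) auto
    also have "\<dots> = 2 * ?d * (c_min c * (\<Sum>(u, v)\<in>cond_edges c. 2 * a * q u v))"
      by (simp add: sum_distrib_left[symmetric] case_prod_unfold)
    also have "\<dots> \<le> 2 * ?d * (c_min c * (\<Sum>(u, v)\<in>cond_edges c. pair_energy \<alpha> k f u v))"
      using cpos q by (intro mult_left_mono sum_mono) auto
    also have "\<dots> \<le> 2 * ?d * (2 * D)"
      unfolding D_def by (intro mult_left_mono c_min_edge_energy_le c0 \<alpha>) auto
    finally show ?thesis using h(1,2) by (auto simp: P_def)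
  qed
  define h where "h x y = (SOME h. P x y h)" for x y
  have "P x y (h x y)" if "x \<noteq> y" for x y
    unfolding h_def by (rule someI_ex[OF ex[OF that]])
  then have h: "\<And>x y. x \<noteq> y \<Longrightarrow> indifferent (h x y) (x, True) (y, True)"
    "\<And>x y. x \<noteq> y \<Longrightarrow> indifferent (h x y) (x, True) (y, False)"
    "\<And>x y. x \<noteq> y \<Longrightarrow> a * c_min c * msum \<beta> k (\<lambda>\<eta>. (f (unsplit \<eta>) - h x y \<eta>)\<^sup>2) \<le> 4 * ?d * D"
    by (simp_all add: P_def)
  have amax: "alpha_max \<alpha> > 0" "\<alpha> x \<le> alpha_max \<alpha>" for x
    using \<alpha> by (auto simp: alpha_max_def Max_gr_iff)
  have r: "alpha_ratio \<alpha> * \<alpha> x \<le> a" for x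
    using amax a0 mult_left_mono[OF amax(2)[of x], of a] by (simp add: alpha_ratio_def a_def[symmetric] field_simps)
  have r0: "alpha_ratio \<alpha> \<ge> 0" using amax a0 by (simp add: alpha_ratio_def a_def)
  obtain m where m: "alpha_ratio \<alpha> * msum \<alpha> k (\<lambda>\<eta>. (f \<eta> - m)\<^sup>2)
    \<le> (\<Sum>x\<in>UNIV. \<Sum>y\<in>UNIV-{x}. msum \<beta> k (\<lambda>\<eta>. (f (unsplit \<eta>) - h x y \<eta>)\<^sup>2))"
    using variance_le_sum_dist_indifferent[OF \<alpha> \<beta>(1,2), of "alpha_ratio \<alpha>" h k f] r r0 h(1,2) unfolding \<beta>(3) by blast
  have D0: "4 * ?d * D \<ge> 0"
    unfolding D_def dirichlet_form_def using c0 \<alpha>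
    by (intro mult_nonneg_nonneg divide_nonneg_nonneg sum_nonneg pair_energy_nonneg) auto
  have "a * alpha_ratio \<alpha> * c_min c * msum \<alpha> k (\<lambda>\<eta>. (f \<eta> - m)\<^sup>2)
     = a * c_min c * (alpha_ratio \<alpha> * msum \<alpha> k (\<lambda>\<eta>. (f \<eta> - m)\<^sup>2))" by (simp only: mult_ac)
  also have "\<dots> \<le> a * c_min c * (\<Sum>x\<in>UNIV. \<Sum>y\<in>UNIV-{x}. msum \<beta> k (\<lambda>\<eta>. (f (unsplit \<eta>) - h x y \<eta>)\<^sup>2))"
    using m a0 cpos by (intro mult_left_mono) auto
  also have "\<dots> = (\<Sum>x\<in>UNIV. \<Sum>y\<in>UNIV-{x}. a * c_min c * msum \<beta> k (\<lambda>\<eta>. (f (unsplit \<eta>) - h x y \<eta>)\<^sup>2))"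
    by (simp only: sum_distrib_left)
  also have "\<dots> \<le> (\<Sum>x\<in>(UNIV::'v set). \<Sum>y\<in>UNIV-{x}. 4 * ?d * D)"
    using h(3) by (intro sum_mono) auto
  also have "\<dots> \<le> (\<Sum>x\<in>(UNIV::'v set). \<Sum>y\<in>(UNIV::'v set). 4 * ?d * D)"
    using D0 by (intro sum_mono sum_mono2) auto
  also have "\<dots> = 4 * (real CARD('v))\<^sup>2 * ?d * D" by (simp add: power2_eq_square)
  finally show ?thesis unfolding a_def D_def by blast
qed

section \<open>Reversibility and eigenfunctions\<close>

lemma move_add_at: "x \<noteq> y \<Longrightarrow> move x y (add_at \<xi> x) = add_at \<xi> y"
  by (auto simp: move_def add_at_def fun_eq_iff)

lemma msum_jump_reversible:
  fixes \<alpha> :: "'v::finite \<Rightarrow> real"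
  assumes "x \<noteq> y"
  shows "msum \<alpha> (Suc k) (\<lambda>\<eta>. real (\<eta> x) * ((\<alpha> y + real (\<eta> y)) * K \<eta> (move x y \<eta>)))
    = msum \<alpha> (Suc k) (\<lambda>\<eta>. real (\<eta> y) * ((\<alpha> x + real (\<eta> x)) * K (move y x \<eta>) \<eta>))"
  unfolding msum_mecke
  using assms by (simp add: move_add_at mult_ac)

text \<open>
  Reversibility exchanges the two ends of every jump, so that the sum may be symmetrised.
\<close>

lemma generator_by_parts:
  fixes c :: "'v::finite \<Rightarrow> 'v \<Rightarrow> real"
  assumes c: "\<And>x y. c x y = c y x" "\<And>x. c x x = 0"
  shows "msum \<alpha> (Suc k) (\<lambda>\<eta>. g \<eta> * - sip_generator c \<alpha> f \<eta>) =
    (\<Sum>x\<in>UNIV. \<Sum>y\<in>UNIV. c x y * msum \<alpha> (Suc k) (\<lambda>\<eta>. real (\<eta> x) * ((\<alpha> y + real (\<eta> y)) *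
        ((f (move x y \<eta>) - f \<eta>) * (g (move x y \<eta>) - g \<eta>))))) / 2"
proof -
  define J where "J x y K = msum \<alpha> (Suc k) (\<lambda>\<eta>. real (\<eta> x) * ((\<alpha> y + real (\<eta> y)) * K \<eta> (move x y \<eta>)))"
    for x y K
  define A where "A = (\<Sum>x\<in>UNIV. \<Sum>y\<in>UNIV. c x y * J x y (\<lambda>\<eta> \<eta>'. g \<eta> * (f \<eta> - f \<eta>')))"
  have "msum \<alpha> (Suc k) (\<lambda>\<eta>. g \<eta> * - sip_generator c \<alpha> f \<eta>)
      = msum \<alpha> (Suc k) (\<lambda>\<eta>. \<Sum>x\<in>UNIV. \<Sum>y\<in>UNIV. c x y *
          (real (\<eta> x) * ((\<alpha> y + real (\<eta> y)) * (g \<eta> * (f \<eta> - f (move x y \<eta>))))))"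
    by (rule msum_cong) (simp add: sip_generator_def sum_distrib_left sum_negf[symmetric] algebra_simps)
  also have "\<dots> = A" by (simp only: msum_sum msum_cmult J_def A_def)
  finally have L: "msum \<alpha> (Suc k) (\<lambda>\<eta>. g \<eta> * - sip_generator c \<alpha> f \<eta>) = A" .
  have "A = (\<Sum>x\<in>UNIV. \<Sum>y\<in>UNIV. c y x * J y x (\<lambda>\<eta> \<eta>'. g \<eta>' * (f \<eta>' - f \<eta>)))"
    unfolding A_def
  proof (intro sum.cong refl)
    fix x y
    show "c x y * J x y (\<lambda>\<eta> \<eta>'. g \<eta> * (f \<eta> - f \<eta>')) = c y x * J y x (\<lambda>\<eta> \<eta>'. g \<eta>' * (f \<eta>' - f \<eta>))"
      using msum_jump_reversible[of x y \<alpha> k "\<lambda>\<eta> \<eta>'. g \<eta> * (f \<eta> - f \<eta>')"] c by (cases "x = y") (auto simp: J_def)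
  qed
  also have "\<dots> = (\<Sum>x\<in>UNIV. \<Sum>y\<in>UNIV. c x y * J x y (\<lambda>\<eta> \<eta>'. g \<eta>' * (f \<eta>' - f \<eta>)))"
    by (rule sum.swap)
  finally have "A + A = (\<Sum>x\<in>UNIV. \<Sum>y\<in>UNIV. c x y *
      (J x y (\<lambda>\<eta> \<eta>'. g \<eta> * (f \<eta> - f \<eta>')) + J x y (\<lambda>\<eta> \<eta>'. g \<eta>' * (f \<eta>' - f \<eta>))))"
    by (simp add: A_def sum.distrib distrib_left)
  also have "\<dots> = (\<Sum>x\<in>UNIV. \<Sum>y\<in>UNIV. c x y * J x y (\<lambda>\<eta> \<eta>'. (f \<eta>' - f \<eta>) * (g \<eta>' - g \<eta>)))"
    unfolding J_def msum_add[symmetric] by (simp add: algebra_simps)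
  finally show ?thesis unfolding L J_def by simp
qed

lemma generator_self_adjoint:
  fixes c :: "'v::finite \<Rightarrow> 'v \<Rightarrow> real"
  assumes "\<And>x y. c x y = c y x" "\<And>x. c x x = 0"
  shows "msum \<alpha> (Suc k) (\<lambda>\<eta>. g \<eta> * - sip_generator c \<alpha> f \<eta>) =
    msum \<alpha> (Suc k) (\<lambda>\<eta>. f \<eta> * - sip_generator c \<alpha> g \<eta>)"
  unfolding generator_by_parts[of c, OF assms] by (simp only: mult.commute[of "f _ - f _"])

lemma generator_dirichlet_form:
  fixes c :: "'v::finite \<Rightarrow> 'v \<Rightarrow> real"
  assumes "\<And>x y. c x y = c y x" "\<And>x. c x x = 0"
  shows "msum \<alpha> (Suc k) (\<lambda>\<eta>. f \<eta> * - sip_generator c \<alpha> f \<eta>) = dirichlet_form c \<alpha> (Suc k) f"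
  unfolding generator_by_parts[of c, OF assms]
  by (simp add: dirichlet_form_def pair_energy_def power2_eq_square mult.assoc)

lemma generator_mean_zero:
  fixes c :: "'v::finite \<Rightarrow> 'v \<Rightarrow> real"
  assumes "\<And>x y. c x y = c y x" "\<And>x. c x x = 0"
  shows "msum \<alpha> (Suc k) (\<lambda>\<eta>. - sip_generator c \<alpha> f \<eta>) = 0"
  using generator_by_parts[of c, OF assms, of \<alpha> k "\<lambda>_. 1" f] by (simp add: msum_def)

lemma sip_generator_linear:
  "sip_generator c \<alpha> (\<lambda>\<eta>. f \<eta> + t * g \<eta>) \<eta> = sip_generator c \<alpha> f \<eta> + t * sip_generator c \<alpha> g \<eta>"
  by (simp add: sip_generator_def sum_distrib_left sum.distrib[symmetric] algebra_simps)

lemma msum_square_eq_0: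
  fixes \<alpha> :: "'v::finite \<Rightarrow> real"
  assumes "\<And>x. \<alpha> x > 0" "msum \<alpha> k (\<lambda>\<eta>. (F \<eta>)\<^sup>2) \<le> 0" "\<eta> \<in> configs k"
  shows "F \<eta> = 0"
proof -
  have w: "weight \<alpha> \<zeta> > 0" for \<zeta> using assms(1) by (rule weight_pos)
  have "weight \<alpha> \<eta> * (F \<eta>)\<^sup>2 \<le> msum \<alpha> k (\<lambda>\<eta>. (F \<eta>)\<^sup>2)"
    unfolding msum_def using assms(3) w by (intro member_le_sum) (auto simp: less_imp_le)
  with assms(2) have "weight \<alpha> \<eta> * (F \<eta>)\<^sup>2 \<le> 0" by simp
  with w[of \<eta>] show ?thesis by (simp add: mult_le_0_iff not_le[symmetric])
qed

text \<open>
  At least one particle is required: for \<open>k = 0\<close> the configuration space is a single point and there is no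
  second eigenvalue.
\<close>

locale sip =
  fixes c :: "'v::finite \<Rightarrow> 'v \<Rightarrow> real" and \<alpha> :: "'v \<Rightarrow> real" and k :: nat
  assumes two_sites: "CARD('v) \<ge> 2"
    and graph: "connected_weighted_graph c"
    and \<alpha>_pos: "\<And>x. \<alpha> x > 0"
    and k_pos: "k > 0"
begin

lemma c_sym: "c x y = c y x" and c_diag: "c x x = 0" and c_nonneg: "c x y \<ge> 0"
  using graph unfolding connected_weighted_graph_def by blast+

lemma \<alpha>_nonneg: "\<alpha> x \<ge> 0" using \<alpha>_pos[of x] by simp

lemma weight_positive: "weight \<alpha> \<eta> > 0" by (rule weight_pos) (rule \<alpha>_pos)

lemma k_Suc: "k = Suc (k - 1)" using k_pos by simp

lemmas self_adjoint = generator_self_adjoint[of c, OF c_sym c_diag, of \<alpha> "k - 1", folded k_Suc]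
lemmas dirichlet = generator_dirichlet_form[of c, OF c_sym c_diag, of \<alpha> "k - 1", folded k_Suc]
lemmas mean_zero = generator_mean_zero[of c, OF c_sym c_diag, of \<alpha> "k - 1", folded k_Suc]

lemma two_distinct_sites: obtains x y :: 'v where "x \<noteq> y"
proof -
  have "\<not> (\<forall>x y :: 'v. x = y)"
  proof
    assume "\<forall>x y :: 'v. x = y"
    then have "(UNIV :: 'v set) = {undefined}" by auto
    then have "CARD('v) = 1" by (metis card.empty card_insert_disjoint empty_iff finite.emptyI One_nat_def)
    with two_sites show False by simp
  qed
  with that show thesis by blast
qed

lemma c_min_pos: "c_min c > 0"
proof -
  obtain x y :: 'v where xy: "x \<noteq> y" by (rule two_distinct_sites)
  have "(x, y) \<in> (cond_edges c)\<^sup>*" using graph by (simp add: connected_weighted_graph_def)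
  then obtain z where "(x, z) \<in> cond_edges c" using xy by (auto elim: converse_rtranclE)
  then have "{c x y | x y. c x y > 0} \<noteq> {}" by (auto simp: cond_edges_def)
  moreover have "finite {c x y | x y. c x y > 0}"
    by (rule finite_subset[of _ "(\<lambda>(x, y). c x y) ` UNIV"]) auto
  ultimately have "c_min c \<in> {c x y | x y. c x y > 0}" unfolding c_min_def by (intro Min_in)
  then show ?thesis by auto
qed

lemma graph_diam_pos: "graph_diam c > 0"
proof -
  obtain x y :: 'v where xy: "x \<noteq> y" by (rule two_distinct_sites)
  have "(x, y) \<in> (cond_edges c)\<^sup>*" using graph by (simp add: connected_weighted_graph_def)
  then obtain p where "p 0 = x" "p (graph_distance c x y) = y"
    by (rule geodesic)
  with xy have "graph_distance c x y > 0" by (cases "graph_distance c x y") auto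
  with graph_distance_le_diam[OF xy, of c] show ?thesis by simp
qed

definition gap_bound :: real where
  "gap_bound = alpha_min \<alpha> * alpha_ratio \<alpha> * c_min c / (4 * (real CARD('v))\<^sup>2 * real (graph_diam c))"

lemma alpha_min_pos: "alpha_min \<alpha> > 0" and alpha_ratio_pos: "alpha_ratio \<alpha> > 0"
  using \<alpha>_pos by (auto simp: alpha_ratio_def alpha_min_def alpha_max_def Max_gr_iff intro!: divide_pos_pos)

lemma gap_bound_pos: "gap_bound > 0"
  unfolding gap_bound_def using alpha_min_pos alpha_ratio_pos c_min_pos graph_diam_pos by simp

lemma poincare: "\<exists>m. gap_bound * msum \<alpha> k (\<lambda>\<eta>. (f \<eta> - m)\<^sup>2) \<le> dirichlet_form c \<alpha> k f"
proof -
  obtain m where m: "alpha_min \<alpha> * alpha_ratio \<alpha> * c_min c * msum \<alpha> k (\<lambda>\<eta>. (f \<eta> - m)\<^sup>2)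
    \<le> 4 * (real CARD('v))\<^sup>2 * real (graph_diam c) * dirichlet_form c \<alpha> k f"
    using sip_poincare[OF graph, of \<alpha>, OF \<alpha>_pos c_min_pos] by blast
  have "4 * (real CARD('v))\<^sup>2 * real (graph_diam c) > 0" using graph_diam_pos by simp
  from pos_divide_le_eq[OF this] m show ?thesis
    unfolding gap_bound_def by (intro exI[of _ m]) (simp add: mult_ac)
qed

lemma eigenspaceD:
  assumes "f \<in> sip_eigenspace c \<alpha> k \<theta>"
  shows "msum \<alpha> k (\<lambda>\<eta>. g \<eta> * - sip_generator c \<alpha> f \<eta>) = \<theta> * msum \<alpha> k (\<lambda>\<eta>. g \<eta> * f \<eta>)"
proof -
  have "msum \<alpha> k (\<lambda>\<eta>. g \<eta> * - sip_generator c \<alpha> f \<eta>) = msum \<alpha> k (\<lambda>\<eta>. \<theta> * (g \<eta> * f \<eta>))"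
    using assms by (intro msum_cong) (auto simp: sip_eigenspace_def mult.left_commute simp flip: mult_minus_right)
  then show ?thesis by (simp only: msum_cmult)
qed

lemma eigenspace_energy:
  assumes "f \<in> sip_eigenspace c \<alpha> k \<theta>"
  shows "dirichlet_form c \<alpha> k f = \<theta> * msum \<alpha> k (\<lambda>\<eta>. (f \<eta>)\<^sup>2)"
  using eigenspaceD[OF assms, of f] by (simp only: dirichlet power2_eq_square)

lemma eigenfunction_norm_pos:
  assumes "f \<in> sip_eigenspace c \<alpha> k \<theta>" "f \<noteq> (\<lambda>_. 0)"
  shows "msum \<alpha> k (\<lambda>\<eta>. (f \<eta>)\<^sup>2) > 0"
proof (rule ccontr)
  assume "\<not> ?thesis"
  then have "f \<eta> = 0" if "\<eta> \<in> configs k" for \<eta>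
    using msum_square_eq_0[of \<alpha> k f, OF \<alpha>_pos _ that] by simp
  then show False using assms by (auto simp: sip_eigenspace_def fun_eq_iff)
qed

text \<open>
  An eigenfunction for \<open>\<theta> \<noteq> 0\<close> has mean zero, so its second moment about any \<open>m\<close> is at least its second
  moment about \<open>0\<close>, and its energy is \<open>\<theta>\<close> times the latter.
\<close>

lemma nonzero_eigenvalue_ge:
  assumes \<theta>: "\<theta> \<in> sip_eigenvalues c \<alpha> k" "\<theta> \<noteq> 0"
  shows "gap_bound \<le> \<theta>"
proof -
  obtain f where f: "f \<in> sip_eigenspace c \<alpha> k \<theta>" "f \<noteq> (\<lambda>_. 0)"
    using \<theta>(1) by (auto simp: sip_eigenvalues_def)
  have "\<theta> * msum \<alpha> k f = 0"
    using eigenspaceD[OF f(1), of "\<lambda>_. 1"] mean_zero[of f] by simp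
  then have mean: "msum \<alpha> k f = 0" using \<theta>(2) by simp
  obtain m where m: "gap_bound * msum \<alpha> k (\<lambda>\<eta>. (f \<eta> - m)\<^sup>2) \<le> dirichlet_form c \<alpha> k f"
    using poincare by blast
  have "msum \<alpha> k (\<lambda>\<eta>. (f \<eta> - m)\<^sup>2) = msum \<alpha> k (\<lambda>\<eta>. ((f \<eta>)\<^sup>2 - (2 * m) * f \<eta>) + m\<^sup>2)"
    by (rule msum_cong) (simp add: power2_eq_square algebra_simps)
  also have "\<dots> = msum \<alpha> k (\<lambda>\<eta>. (f \<eta>)\<^sup>2) + msum \<alpha> k (\<lambda>_. m\<^sup>2)"
    unfolding msum_add msum_diff msum_cmult mean by simp
  finally have "msum \<alpha> k (\<lambda>\<eta>. (f \<eta>)\<^sup>2) \<le> msum \<alpha> k (\<lambda>\<eta>. (f \<eta> - m)\<^sup>2)"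
    using msum_nonneg[OF \<alpha>_nonneg, of k "\<lambda>_. m\<^sup>2"] by simp
  then have "gap_bound * msum \<alpha> k (\<lambda>\<eta>. (f \<eta>)\<^sup>2) \<le> \<theta> * msum \<alpha> k (\<lambda>\<eta>. (f \<eta>)\<^sup>2)"
    using m gap_bound_pos unfolding eigenspace_energy[OF f(1)]
    by (meson mult_left_mono order_trans less_imp_le)
  then show ?thesis using eigenfunction_norm_pos[OF f] by simp
qed

lemma eigenspace_0_constant:
  assumes "f \<in> sip_eigenspace c \<alpha> k 0"
  shows "\<exists>m. \<forall>\<eta>. f \<eta> = m * of_bool (\<eta> \<in> configs k)"
proof -
  obtain m where m: "gap_bound * msum \<alpha> k (\<lambda>\<eta>. (f \<eta> - m)\<^sup>2) \<le> 0"
    using poincare[of f] unfolding eigenspace_energy[OF assms] by auto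
  then have "msum \<alpha> k (\<lambda>\<eta>. (f \<eta> - m)\<^sup>2) \<le> 0"
    using gap_bound_pos by (simp add: mult_le_0_iff)
  then have "f \<eta> - m = 0" if "\<eta> \<in> configs k" for \<eta>
    using msum_square_eq_0[of \<alpha> k "\<lambda>\<eta>. f \<eta> - m", OF \<alpha>_pos _ that] by simp
  then show ?thesis
    using assms by (intro exI[of _ m]) (auto simp: sip_eigenspace_def)
qed

end

section \<open>The spectrum\<close>

lemma quadratic_nonneg_imp_linear_zero:
  fixes A B :: real
  assumes "\<And>t. 0 \<le> 2 * t * A + t\<^sup>2 * B" "A \<ge> 0"
  shows "A = 0"
proof (rule ccontr)
  assume "A \<noteq> 0"
  then have A: "A > 0" using assms(2) by simp
  define e where "e = A / (\<bar>B\<bar> + 1)"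
  have e: "e > 0" using A by (simp add: e_def)
  have "0 \<le> 2 * (- e) * A + (- e)\<^sup>2 * B" by (rule assms(1))
  then have "0 \<le> e * (e * B - 2 * A)" by (simp add: power2_eq_square algebra_simps)
  then have "2 * A \<le> e * B" using e by (simp add: zero_le_mult_iff)
  also have "\<dots> \<le> e * (\<bar>B\<bar> + 1)" using e by (intro mult_left_mono) auto
  also have "\<dots> = A" by (simp add: e_def)
  finally show False using A by simp
qed

lemma sum_fun_apply: "(\<Sum>i\<in>S. F i) x = (\<Sum>i\<in>S. F i x)"
  for F :: "'i \<Rightarrow> 'a \<Rightarrow> real"
  by (induction S rule: infinite_finite_induct) auto

context sip
begin

definition unit_sphere :: "(('v \<Rightarrow> nat) \<Rightarrow> real) set" where
  "unit_sphere = {f. (\<forall>\<eta>. \<eta> \<notin> configs k \<longrightarrow> f \<eta> = 0) \<and> msum \<alpha> k f = 0 \<and> msum \<alpha> k (\<lambda>\<eta>. (f \<eta>)\<^sup>2) = 1}"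

text \<open>
  In the product topology on functions, the normalised functions form a closed subset of a product of
  compact intervals, because all weights are positive.
\<close>

lemma compact_unit_sphere: "compact unit_sphere"
proof -
  define I where "I \<eta> = (if \<eta> \<in> configs k then {- (1 / sqrt (weight \<alpha> \<eta>))..1 / sqrt (weight \<alpha> \<eta>)} else {0})"
    for \<eta> :: "'v \<Rightarrow> nat"
  have "compactin (product_topology (\<lambda>_. euclidean) UNIV) (\<Pi>\<^sub>E \<eta>\<in>UNIV. I \<eta>)"
    unfolding compactin_PiE by (auto simp: I_def)
  then have box: "compact (\<Pi>\<^sub>E \<eta>\<in>UNIV. I \<eta>)"
    unfolding euclidean_product_topology by simp
  have "closed {f :: ('v \<Rightarrow> nat) \<Rightarrow> real. msum \<alpha> k f = 0}" "closed {f :: ('v \<Rightarrow> nat) \<Rightarrow> real. msum \<alpha> k (\<lambda>\<eta>. (f \<eta>)\<^sup>2) = 1}"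
    unfolding msum_def by (intro closed_Collect_eq continuous_intros continuous_on_product_coordinates)+
  with box have "compact ((\<Pi>\<^sub>E \<eta>\<in>UNIV. I \<eta>) \<inter> ({f. msum \<alpha> k f = 0} \<inter> {f. msum \<alpha> k (\<lambda>\<eta>. (f \<eta>)\<^sup>2) = 1}))"
    by (intro compact_Int_closed closed_Int)
  also have "(\<Pi>\<^sub>E \<eta>\<in>UNIV. I \<eta>) \<inter> ({f. msum \<alpha> k f = 0} \<inter> {f. msum \<alpha> k (\<lambda>\<eta>. (f \<eta>)\<^sup>2) = 1}) = unit_sphere"
  proof -
    have "f \<eta> \<in> I \<eta>" if "msum \<alpha> k (\<lambda>\<eta>. (f \<eta>)\<^sup>2) = 1" "\<eta> \<in> configs k" for f \<eta>
    proof -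
      have "weight \<alpha> \<eta> * (f \<eta>)\<^sup>2 \<le> 1"
        unfolding that(1)[symmetric] msum_def using that(2) weight_positive
        by (intro member_le_sum) (auto simp: less_imp_le)
      then have "(f \<eta>)\<^sup>2 \<le> (1 / sqrt (weight \<alpha> \<eta>))\<^sup>2"
        using weight_positive[of \<eta>] by (simp add: power_divide field_simps)
      then have "\<bar>f \<eta>\<bar> \<le> 1 / sqrt (weight \<alpha> \<eta>)"
        using weight_positive[of \<eta>] by (subst (asm) abs_le_square_iff[symmetric]) simp
      then show ?thesis using that(2) by (auto simp: I_def abs_le_iff)
    qed
    then have "f \<in> (\<Pi>\<^sub>E \<eta>\<in>UNIV. I \<eta>)" if "f \<in> unit_sphere" for f
      using that by (auto simp: unit_sphere_def PiE_iff) (simp add: I_def)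
    moreover have "f \<eta> = 0" if "f \<in> (\<Pi>\<^sub>E \<eta>\<in>UNIV. I \<eta>)" "\<eta> \<notin> configs k" for f \<eta>
      using PiE_mem[OF that(1), of \<eta>] that(2) by (simp add: I_def)
    ultimately show ?thesis by (auto simp: unit_sphere_def)
  qed
  finally show ?thesis .
qed

lemma unit_sphere_normalize:
  assumes "\<And>\<eta>. \<eta> \<notin> configs k \<Longrightarrow> g \<eta> = 0" "msum \<alpha> k g = 0" "msum \<alpha> k (\<lambda>\<eta>. (g \<eta>)\<^sup>2) > 0"
  shows "(\<lambda>\<eta>. g \<eta> / sqrt (msum \<alpha> k (\<lambda>\<eta>. (g \<eta>)\<^sup>2))) \<in> unit_sphere"
  using assms msum_cmult[of \<alpha> k "1 / sqrt (msum \<alpha> k (\<lambda>\<eta>. (g \<eta>)\<^sup>2))" g]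
    msum_cmult[of \<alpha> k "1 / msum \<alpha> k (\<lambda>\<eta>. (g \<eta>)\<^sup>2)" "\<lambda>\<eta>. (g \<eta>)\<^sup>2"]
  by (simp add: unit_sphere_def power_divide)

lemma unit_sphere_nonempty: "unit_sphere \<noteq> {}"
proof -
  obtain x y :: 'v where xy: "x \<noteq> y" by (rule two_distinct_sites)
  define \<delta> where "\<delta> z = (\<lambda>w. if w = z then k else 0)" for z :: 'v
  have \<delta>: "\<delta> z \<in> configs k" for z by (simp add: \<delta>_def configs_def)
  have ne: "\<delta> x \<noteq> \<delta> y" using xy k_pos by (auto simp: \<delta>_def fun_eq_iff)
  define g where "g \<eta> = (if \<eta> = \<delta> x then 1 / weight \<alpha> \<eta> else if \<eta> = \<delta> y then - 1 / weight \<alpha> \<eta> else 0)" for \<eta>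
  have "weight \<alpha> \<eta> * g \<eta> = of_bool (\<eta> = \<delta> x) - of_bool (\<eta> = \<delta> y)" for \<eta>
    using weight_positive[of \<eta>] ne by (auto simp: g_def)
  then have "msum \<alpha> k g = 0"
    using \<delta> by (simp add: msum_def sum_subtractf)
  moreover have "msum \<alpha> k (\<lambda>\<eta>. (g \<eta>)\<^sup>2) > 0"
  proof (rule ccontr)
    assume "\<not> ?thesis"
    then have "g (\<delta> x) = 0" using msum_square_eq_0[of \<alpha> k g, OF \<alpha>_pos _ \<delta>] by simp
    then show False using weight_positive[of "\<delta> x"] by (simp add: g_def)
  qed
  moreover have "g \<eta> = 0" if "\<eta> \<notin> configs k" for \<eta> using that \<delta> by (auto simp: g_def)
  ultimately show ?thesis using unit_sphere_normalize[of g] by auto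
qed

text \<open>
  Minimise the energy over the normalised functions of mean zero. The residual \<open>R\<close> of the eigenvalue
  equation at a minimiser again has mean zero, so it is an admissible direction; perturbing the minimiser in this
  direction changes the excess of the energy over \<open>\<theta>\<close> times the squared norm, which is least at the
  minimiser, to first order by a multiple of the squared norm of \<open>R\<close>, which must vanish. The
  eigenvalue is not \<open>0\<close> since the kernel consists of constants.
\<close>

lemma exists_nonzero_eigenvalue: "\<exists>\<theta>\<in>sip_eigenvalues c \<alpha> k. \<theta> \<noteq> 0"
proof -
  let ?E = "\<lambda>f. msum \<alpha> k (\<lambda>\<eta>. f \<eta> * - sip_generator c \<alpha> f \<eta>)"
  have "continuous_on unit_sphere ?E"
    unfolding msum_def sip_generator_def
    by (intro continuous_intros continuous_on_subset[OF continuous_on_product_coordinates subset_UNIV])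
  from continuous_attains_inf[OF compact_unit_sphere unit_sphere_nonempty this]
  obtain f where f: "f \<in> unit_sphere" and min: "\<And>g. g \<in> unit_sphere \<Longrightarrow> ?E f \<le> ?E g" by blast
  define \<theta> where "\<theta> = ?E f"
  have f0: "f \<eta> = 0" if "\<eta> \<notin> configs k" for \<eta> using f that by (simp add: unit_sphere_def)
  have fm: "msum \<alpha> k f = 0" "msum \<alpha> k (\<lambda>\<eta>. (f \<eta>)\<^sup>2) = 1" using f by (auto simp: unit_sphere_def)
  have ineq: "\<theta> * msum \<alpha> k (\<lambda>\<eta>. (g \<eta>)\<^sup>2) \<le> ?E g"
    if g: "\<And>\<eta>. \<eta> \<notin> configs k \<Longrightarrow> g \<eta> = 0" "msum \<alpha> k g = 0" for g
  proof (cases "msum \<alpha> k (\<lambda>\<eta>. (g \<eta>)\<^sup>2) > 0")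
    case True
    define s where "s = msum \<alpha> k (\<lambda>\<eta>. (g \<eta>)\<^sup>2)"
    have s: "s > 0" using True by (simp add: s_def)
    have "?E (\<lambda>\<eta>. 0 + (1 / sqrt s) * g \<eta>) = msum \<alpha> k (\<lambda>\<eta>. (1 / s) * (g \<eta> * - sip_generator c \<alpha> g \<eta>))"
      unfolding sip_generator_linear using s
      by (intro msum_cong) (simp add: sip_generator_def divide_simps)
    then have "?E (\<lambda>\<eta>. g \<eta> / sqrt s) = ?E g / s"
      unfolding msum_cmult by simp
    moreover have "\<theta> \<le> ?E (\<lambda>\<eta>. g \<eta> / sqrt s)"
      unfolding \<theta>_def s_def by (intro min unit_sphere_normalize g True)
    ultimately show ?thesis using s by (simp add: s_def pos_le_divide_eq)
  next
    case False
    then have "g \<eta> = 0" if "\<eta> \<in> configs k" for \<eta>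
      using msum_square_eq_0[of \<alpha> k g, OF \<alpha>_pos _ that] by simp
    then have "g = (\<lambda>_. 0)" using g(1) by blast
    then show ?thesis by (simp add: msum_def)
  qed
  define R where "R \<eta> = (if \<eta> \<in> configs k then - sip_generator c \<alpha> f \<eta> - \<theta> * f \<eta> else 0)" for \<eta>
  have R: "msum \<alpha> k (\<lambda>\<eta>. g \<eta> * R \<eta>) = msum \<alpha> k (\<lambda>\<eta>. g \<eta> * - sip_generator c \<alpha> f \<eta>) - \<theta> * msum \<alpha> k (\<lambda>\<eta>. g \<eta> * f \<eta>)" for g
    unfolding msum_cmult[symmetric] msum_diff[symmetric]
    by (rule msum_cong) (simp add: R_def algebra_simps)
  have Rm: "msum \<alpha> k R = 0" using R[of "\<lambda>_. 1"] mean_zero[of f] fm by simp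
  have "0 \<le> 2 * t * msum \<alpha> k (\<lambda>\<eta>. (R \<eta>)\<^sup>2) + t\<^sup>2 * (?E R - \<theta> * msum \<alpha> k (\<lambda>\<eta>. (R \<eta>)\<^sup>2))" for t
  proof -
    let ?g = "\<lambda>\<eta>. f \<eta> + t * R \<eta>"
    have "\<theta> * msum \<alpha> k (\<lambda>\<eta>. (?g \<eta>)\<^sup>2) \<le> ?E ?g"
      by (rule ineq) (auto simp: f0 R_def msum_add msum_cmult fm Rm[unfolded R_def])
    also have "?E ?g = msum \<alpha> k (\<lambda>\<eta>. f \<eta> * - sip_generator c \<alpha> f \<eta>
        + t * (f \<eta> * - sip_generator c \<alpha> R \<eta>) + t * (R \<eta> * - sip_generator c \<alpha> f \<eta>)
        + t\<^sup>2 * (R \<eta> * - sip_generator c \<alpha> R \<eta>))"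
      unfolding sip_generator_linear by (rule msum_cong) (simp add: power2_eq_square algebra_simps)
    also have "\<dots> = \<theta> + 2 * t * msum \<alpha> k (\<lambda>\<eta>. R \<eta> * - sip_generator c \<alpha> f \<eta>) + t\<^sup>2 * ?E R"
      unfolding msum_add msum_cmult self_adjoint[of f R] by (simp add: \<theta>_def)
    also have "msum \<alpha> k (\<lambda>\<eta>. (?g \<eta>)\<^sup>2) = msum \<alpha> k (\<lambda>\<eta>. (f \<eta>)\<^sup>2 + 2 * t * (R \<eta> * f \<eta>) + t\<^sup>2 * (R \<eta>)\<^sup>2)"
      by (rule msum_cong) (simp add: power2_eq_square algebra_simps)
    also have "\<dots> = 1 + 2 * t * msum \<alpha> k (\<lambda>\<eta>. R \<eta> * f \<eta>) + t\<^sup>2 * msum \<alpha> k (\<lambda>\<eta>. (R \<eta>)\<^sup>2)"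
      unfolding msum_add msum_cmult fm ..
    finally have "0 \<le> 2 * t * (msum \<alpha> k (\<lambda>\<eta>. R \<eta> * - sip_generator c \<alpha> f \<eta>) - \<theta> * msum \<alpha> k (\<lambda>\<eta>. R \<eta> * f \<eta>))
       + t\<^sup>2 * (?E R - \<theta> * msum \<alpha> k (\<lambda>\<eta>. (R \<eta>)\<^sup>2))"
      by (simp add: algebra_simps)
    then show ?thesis unfolding R[symmetric] by (simp add: power2_eq_square)
  qed
  from quadratic_nonneg_imp_linear_zero[OF this msum_nonneg[OF \<alpha>_nonneg]]
  have "msum \<alpha> k (\<lambda>\<eta>. (R \<eta>)\<^sup>2) = 0" by simp
  then have "R \<eta> = 0" if "\<eta> \<in> configs k" for \<eta>
    using msum_square_eq_0[of \<alpha> k R, OF \<alpha>_pos _ that] by simp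
  then have eig: "f \<in> sip_eigenspace c \<alpha> k \<theta>"
    using f0 by (auto simp: sip_eigenspace_def R_def split: if_splits)
  have "\<theta> \<noteq> 0"
  proof
    assume "\<theta> = 0"
    then obtain m where m: "\<And>\<eta>. f \<eta> = m * of_bool (\<eta> \<in> configs k)"
      using eigenspace_0_constant eig by blast
    have "msum \<alpha> k (\<lambda>\<eta>. (f \<eta>)\<^sup>2) = m * msum \<alpha> k f"
      unfolding msum_cmult[symmetric] by (rule msum_cong) (simp add: m power2_eq_square)
    then show False using fm by simp
  qed
  moreover have "f \<noteq> (\<lambda>_. 0)" using fm(2) by (auto simp: msum_def)
  ultimately show ?thesis using eig by (auto simp: sip_eigenvalues_def)
qed

definition point_masses :: "(('v \<Rightarrow> nat) \<Rightarrow> real) set" where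
  "point_masses = (\<lambda>\<zeta> \<eta>. of_bool (\<eta> = \<zeta>)) ` configs k"

lemma finite_point_masses: "finite point_masses"
  by (simp add: point_masses_def)

lemma supported_in_span:
  assumes "\<And>\<eta>. \<eta> \<notin> configs k \<Longrightarrow> f \<eta> = 0"
  shows "f \<in> fun_space.span point_masses"
proof -
  have "f = (\<Sum>\<zeta>\<in>configs k. (\<lambda>\<eta>. f \<zeta> * of_bool (\<eta> = \<zeta>)))"
  proof
    fix \<eta>
    have "(\<Sum>\<zeta>\<in>configs k. f \<zeta> * of_bool (\<eta> = \<zeta>)) = (\<Sum>\<zeta>\<in>configs k. if \<eta> = \<zeta> then f \<zeta> else 0)"
      by (intro sum.cong) auto
    then show "f \<eta> = (\<Sum>\<zeta>\<in>configs k. (\<lambda>\<eta>. f \<zeta> * of_bool (\<eta> = \<zeta>))) \<eta>"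
      using assms by (simp add: sum_fun_apply)
  qed
  moreover have "(\<Sum>\<zeta>\<in>configs k. (\<lambda>\<eta>. f \<zeta> * of_bool (\<eta> = \<zeta>))) \<in> fun_space.span point_masses"
    by (intro fun_space.span_sum fun_space.span_scale fun_space.span_base) (auto simp: point_masses_def)
  ultimately show ?thesis by simp
qed

lemma eigenspace_subset_span: "sip_eigenspace c \<alpha> k \<theta> \<subseteq> fun_space.span point_masses"
  by (auto simp: sip_eigenspace_def intro!: supported_in_span)

lemma eigenfunctions_orthogonal:
  assumes "f \<in> sip_eigenspace c \<alpha> k \<theta>" "g \<in> sip_eigenspace c \<alpha> k \<theta>'" "\<theta> \<noteq> \<theta>'"
  shows "msum \<alpha> k (\<lambda>\<eta>. f \<eta> * g \<eta>) = 0"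
proof -
  have "\<theta> * msum \<alpha> k (\<lambda>\<eta>. g \<eta> * f \<eta>) = \<theta>' * msum \<alpha> k (\<lambda>\<eta>. f \<eta> * g \<eta>)"
    using eigenspaceD[OF assms(1), of g] eigenspaceD[OF assms(2), of f] self_adjoint[of g f] by simp
  then show ?thesis using assms(3) by (simp add: mult.commute[of "g _"])
qed

text \<open>
  Eigenfunctions for different eigenvalues are orthogonal, hence independent, and they lie in a space spanned by
  finitely many point masses.
\<close>

lemma finite_eigenvalues: "finite (sip_eigenvalues c \<alpha> k)"
proof -
  define F where "F \<theta> = (SOME f. f \<in> sip_eigenspace c \<alpha> k \<theta> \<and> f \<noteq> (\<lambda>_. 0))" for \<theta>
  have F: "F \<theta> \<in> sip_eigenspace c \<alpha> k \<theta>" "F \<theta> \<noteq> (\<lambda>_. 0)" if "\<theta> \<in> sip_eigenvalues c \<alpha> k" for \<theta>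
  proof -
    have "\<exists>f. f \<in> sip_eigenspace c \<alpha> k \<theta> \<and> f \<noteq> (\<lambda>_. 0)" using that by (auto simp: sip_eigenvalues_def)
    from someI_ex[OF this] show "F \<theta> \<in> sip_eigenspace c \<alpha> k \<theta>" "F \<theta> \<noteq> (\<lambda>_. 0)" by (auto simp: F_def)
  qed
  have pos: "msum \<alpha> k (\<lambda>\<eta>. F \<theta> \<eta> * F \<theta> \<eta>) > 0" if "\<theta> \<in> sip_eigenvalues c \<alpha> k" for \<theta>
    using eigenfunction_norm_pos[OF F[OF that]] by (simp add: power2_eq_square)
  have inj: "inj_on F (sip_eigenvalues c \<alpha> k)"
  proof (rule inj_onI, rule ccontr)
    fix \<theta> \<theta>' assume a: "\<theta> \<in> sip_eigenvalues c \<alpha> k" "\<theta>' \<in> sip_eigenvalues c \<alpha> k" "F \<theta> = F \<theta>'" "\<theta> \<noteq> \<theta>'"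
    then show False
      using eigenfunctions_orthogonal[OF F(1)[OF a(1)] F(1)[OF a(2)] a(4)] pos[OF a(1)] by simp
  qed
  have "fun_space.independent (F ` sip_eigenvalues c \<alpha> k)"
    unfolding fun_space.dependent_explicit
  proof (intro notI, elim exE conjE bexE)
    fix t u v
    assume t: "finite t" "t \<subseteq> F ` sip_eigenvalues c \<alpha> k" "(\<Sum>v\<in>t. (\<lambda>x. u v * v x)) = 0"
      and v: "v \<in> t" "u v \<noteq> 0"
    then obtain \<theta> where \<theta>: "F \<theta> \<in> t" "u (F \<theta>) \<noteq> 0" "\<theta> \<in> sip_eigenvalues c \<alpha> k" by auto
    have 0: "(\<Sum>v\<in>t. u v * v \<eta>) = 0" for \<eta>
      using fun_cong[OF t(3), of \<eta>] by (simp add: sum_fun_apply)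
    have "0 = msum \<alpha> k (\<lambda>\<eta>. \<Sum>v\<in>t. u v * (v \<eta> * F \<theta> \<eta>))"
      by (simp add: mult.assoc[symmetric] sum_distrib_right[symmetric] 0 msum_def)
    also have "\<dots> = (\<Sum>v\<in>t. u v * msum \<alpha> k (\<lambda>\<eta>. v \<eta> * F \<theta> \<eta>))"
      by (simp only: msum_sum msum_cmult)
    also have "\<dots> = u (F \<theta>) * msum \<alpha> k (\<lambda>\<eta>. F \<theta> \<eta> * F \<theta> \<eta>)"
    proof (subst sum.remove[OF t(1) \<theta>(1)], subst sum.neutral)
      show "\<forall>v\<in>t - {F \<theta>}. u v * msum \<alpha> k (\<lambda>\<eta>. v \<eta> * F \<theta> \<eta>) = 0"
      proof
        fix v assume "v \<in> t - {F \<theta>}"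
        then obtain \<theta>' where "\<theta>' \<in> sip_eigenvalues c \<alpha> k" "v = F \<theta>'" "\<theta>' \<noteq> \<theta>" using t(2) by auto
        then show "u v * msum \<alpha> k (\<lambda>\<eta>. v \<eta> * F \<theta> \<eta>) = 0"
          using eigenfunctions_orthogonal[OF F(1) F(1)[OF \<theta>(3)], of \<theta>'] by simp
      qed
    qed simp
    finally show False using \<theta>(2) pos[OF \<theta>(3)] by simp
  qed
  then have "finite (F ` sip_eigenvalues c \<alpha> k)"
    using fun_space.independent_span_bound[OF finite_point_masses] F(1) eigenspace_subset_span by blast
  then show ?thesis using inj by (rule finite_imageD)
qed

lemma eigenspace_dim_pos:
  assumes "\<theta> \<in> sip_eigenvalues c \<alpha> k"
  shows "fun_space.dim (sip_eigenspace c \<alpha> k \<theta>) > 0"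
proof -
  obtain f where f: "f \<in> sip_eigenspace c \<alpha> k \<theta>" "f \<noteq> (\<lambda>_. 0)"
    using assms by (auto simp: sip_eigenvalues_def)
  obtain B where B: "B \<subseteq> sip_eigenspace c \<alpha> k \<theta>" "fun_space.independent B"
    "sip_eigenspace c \<alpha> k \<theta> \<subseteq> fun_space.span B" "card B = fun_space.dim (sip_eigenspace c \<alpha> k \<theta>)"
    using fun_space.basis_exists by blast
  have "finite B"
    using fun_space.independent_span_bound[OF finite_point_masses B(2)] B(1) eigenspace_subset_span by blast
  moreover have "B \<noteq> {}" using B(3) f by (auto simp: zero_fun_def)
  ultimately show ?thesis using B(4) by (metis card_gt_0_iff)
qed

lemma constant_in_eigenspace_0: "(\<lambda>\<eta>. of_bool (\<eta> \<in> configs k)) \<in> sip_eigenspace c \<alpha> k 0"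
proof -
  let ?f = "\<lambda>\<eta>. of_bool (\<eta> \<in> configs k) :: real"
  have key: "real (\<eta> x) * (?f (move x y \<eta>) - ?f \<eta>) = 0" if "\<eta> \<in> configs k" for \<eta> :: "'v \<Rightarrow> nat" and x y
  proof (cases "\<eta> x")
    case (Suc n)
    define \<xi> where "\<xi> = \<eta>(x := n)"
    have \<eta>: "\<eta> = add_at \<xi> x" using Suc by (auto simp: \<xi>_def add_at_def)
    have "\<xi> \<in> configs (k - 1)" using that add_at_configs_iff[of \<xi> x "k - 1"] k_pos by (simp add: \<eta>)
    moreover have "move x y \<eta> = add_at \<xi> y" unfolding \<eta> by (auto simp: move_def add_at_def fun_eq_iff)
    ultimately have "move x y \<eta> \<in> configs k" using add_at_configs_iff[of \<xi> y "k - 1"] k_pos by simp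
    then show ?thesis using that by simp
  qed simp
  then have "c x y * real (\<eta> x) * (\<alpha> y + real (\<eta> y)) * (?f (move x y \<eta>) - ?f \<eta>) = 0"
    if "\<eta> \<in> configs k" for \<eta> x y
    using key[OF that, of x y] by auto
  then have "sip_generator c \<alpha> ?f \<eta> = 0" if "\<eta> \<in> configs k" for \<eta>
    unfolding sip_generator_def using that by (intro sum.neutral ballI) auto
  then show ?thesis by (simp add: sip_eigenspace_def)
qed

lemma constant_nonzero: "(\<lambda>\<eta> :: 'v \<Rightarrow> nat. of_bool (\<eta> \<in> configs k) :: real) \<noteq> (\<lambda>_. 0)"
proof
  assume "(\<lambda>\<eta> :: 'v \<Rightarrow> nat. of_bool (\<eta> \<in> configs k) :: real) = (\<lambda>_. 0)"
  from fun_cong[OF this, of "\<lambda>z. if z = undefined then k else 0"] show False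
    by (simp add: configs_def)
qed

lemma dim_eigenspace_0: "fun_space.dim (sip_eigenspace c \<alpha> k 0) = 1"
proof (rule fun_space.dim_unique)
  let ?f = "\<lambda>\<eta> :: 'v \<Rightarrow> nat. of_bool (\<eta> \<in> configs k) :: real"
  have "?f \<noteq> 0" using constant_nonzero by (simp add: zero_fun_def)
  then show "fun_space.independent {?f}" by simp
  show "{?f} \<subseteq> sip_eigenspace c \<alpha> k 0" using constant_in_eigenspace_0 by simp
  show "sip_eigenspace c \<alpha> k 0 \<subseteq> fun_space.span {?f}"
  proof
    fix f assume "f \<in> sip_eigenspace c \<alpha> k 0"
    then obtain m where "f = (\<lambda>\<eta>. m * ?f \<eta>)" using eigenspace_0_constant by blast
    then show "f \<in> fun_space.span {?f}" by (simp add: fun_space.span_scale fun_space.span_base)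
  qed
qed simp

text \<open>
  The eigenvalue \<open>0\<close> is the least and has multiplicity one, so it occupies exactly the first place of the
  spectrum; and there is a second place, which holds some nonzero eigenvalue.
\<close>

theorem gap_bound_le_sip_gap_k: "gap_bound \<le> sip_gap_k c \<alpha> k"
proof -
  let ?E = "sip_eigenvalues c \<alpha> k"
  let ?block = "\<lambda>\<theta>. replicate (fun_space.dim (sip_eigenspace c \<alpha> k \<theta>)) \<theta>"
  have 0: "0 \<in> ?E"
    using constant_in_eigenspace_0 constant_nonzero by (auto simp: sip_eigenvalues_def)
  have "0 \<le> \<theta>" if "\<theta> \<in> ?E" for \<theta>
    using nonzero_eigenvalue_ge[OF that] gap_bound_pos by (cases "\<theta> = 0") auto
  then have Min: "Min ?E = 0" using 0 finite_eigenvalues by (intro Min_eqI) auto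
  let ?rest = "sorted_list_of_set (?E - {0})"
  have "sorted_list_of_set ?E = 0 # ?rest"
    using sorted_list_of_set_nonempty[OF finite_eigenvalues] 0 Min by auto
  then have spec: "sip_spectrum c \<alpha> k = 0 # concat (map ?block ?rest)"
    by (simp add: sip_spectrum_def dim_eigenspace_0)
  have rest: "set ?rest = ?E - {0}" using finite_eigenvalues by simp
  obtain \<theta> where "\<theta> \<in> ?E" "\<theta> \<noteq> 0" using exists_nonzero_eigenvalue by blast
  then have "\<theta> \<in> set (concat (map ?block ?rest))" using eigenspace_dim_pos by (auto simp: rest)
  then have "concat (map ?block ?rest) \<noteq> []" by auto
  then have "sip_spectrum c \<alpha> k ! 1 \<in> set (concat (map ?block ?rest))"
    unfolding spec by (simp only: One_nat_def nth_Cons_Suc) (intro nth_mem, simp only: length_greater_0_conv not_False_eq_True)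
  then have "sip_spectrum c \<alpha> k ! 1 \<in> ?E - {0}" using rest by auto
  then show ?thesis unfolding sip_gap_k_def by (intro nonzero_eigenvalue_ge) auto
qed

end

theorem theorem2p2:
  fixes c :: "'v::finite \<Rightarrow> 'v \<Rightarrow> real" and \<alpha> :: "'v \<Rightarrow> real"
  assumes "CARD('v) \<ge> 2"
    and "connected_weighted_graph c"
    and "\<And>x. \<alpha> x > 0"
  shows "alpha_min \<alpha> *
      (1 / 54 * (alpha_ratio \<alpha> / (6 * exp 1) powr (alpha_min \<alpha> / alpha_ratio \<alpha>)) *
        (c_min c / (real CARD('v) ^ 2 * real (graph_diam c))))
    \<le> sip_gap c \<alpha>"
    (is "?L \<le> _")
  unfolding sip_gap_def
proof (rule cINF_greatest)
  fix k :: nat assume k: "k \<in> {2..}"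
  interpret sip c \<alpha> k using assms k by unfold_locales auto
  \<comment> \<open>The factor \<open>54 * P\<close> in the claim is weaker than the factor \<open>4\<close> of the Poincare inequality.\<close>
  define P where "P = (6 * exp 1 :: real) powr (alpha_min \<alpha> / alpha_ratio \<alpha>)"
  have "P \<ge> 1"
    unfolding P_def using alpha_min_pos alpha_ratio_pos
    by (intro ge_one_powr_ge_zero) (auto simp: intro: order_trans[OF _ mult_mono[of 1 6 1 "exp 1"]])
  then have P: "1 / (54 * P) \<le> 1 / 4" by (intro divide_left_mono) auto
  have "?L = (alpha_min \<alpha> * alpha_ratio \<alpha> * c_min c / ((real CARD('v))\<^sup>2 * real (graph_diam c))) * (1 / (54 * P))"
    unfolding P_def[symmetric] by (simp add: mult_ac)
  also have "\<dots> \<le> (alpha_min \<alpha> * alpha_ratio \<alpha> * c_min c / ((real CARD('v))\<^sup>2 * real (graph_diam c))) * (1 / 4)"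
    using P alpha_min_pos alpha_ratio_pos c_min_pos by (intro mult_left_mono) auto
  also have "\<dots> = gap_bound" by (simp add: gap_bound_def)
  also have "\<dots> \<le> sip_gap_k c \<alpha> k" by (rule gap_bound_le_sip_gap_k)
  finally show "?L \<le> sip_gap_k c \<alpha> k" .
qed simp

end
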